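(* There is no number $\mu$ such that $\mu\langle n,m\rangle$ is defined and $\mathcal M(\mu\langle n,m\rangle)$ holds for all $n,m$, and such that for all $n$, $\mathcal M(n)\leftrightarrow\exists m\,\mathcal T(\mu\langle n,m\rangle)$.
   Context: Work in Heyting arithmetic extended by unary predicates $\mathcal M$ ("Meaningful condition") and $\mathcal T$ ("True condition"). $\langle\cdot,\cdot\rangle$ is Cantor pairing; $en$ denotes Kleene application of the $e$-th partial recursive function to $n$, $en\!\downarrow$ that it is defined, and $\Lambda m.\tau(m)$ an index of $m\mapsto\tau(m)$. $\Xi(f,g)$ is a fixed primitive recursive injective coding of pairs. Axioms: (X1) $\forall f,g\,[\mathcal M(\Xi(f,g))\to(\mathcal T(\Xi(f,g))\leftrightarrow\forall n(fn\!\downarrow\wedge\mathcal T(fn)\to gn\!\downarrow\wedge\mathcal T(gn)))]$; (X2) $\forall f,g\,[(\forall n(fn\!\downarrow\to\mathcal M(fn)))\wedge(\forall n(fn\!\downarrow\wedge gn\!\downarrow\wedge\mathcal T(fn)\to\mathcal M(gn)))\to\mathcal M(\Xi(f,g))]$. There is a condition $\bot$ with $\mathcal M(\bot)$ and $\neg\mathcal T(\bot)$. *)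

theory Defs
  imports Main
begin

section \<open>The language of Heyting arithmetic with two extra predicates\<close>

text \<open>
  Names of primitive recursive functions. A name may be applied to an argument list of any length,
  which is read as if it were continued by zeros (see the rules \<open>pr_\<dots>\<close> of \<open>prov\<close> below).
\<close>

datatype prfun = PZero | PSucc | PProj nat | PComp prfun "prfun list" | PRec prfun prfun

datatype tm = Var nat | Zero | Succ tm | Fn prfun "tm list"

text \<open>Variables are de Bruijn indices; \<open>Forall\<close> and \<open>Exists\<close> bind index 0.\<close>

datatype fm =
    Eq tm tm  (infix \<open>\<^bold>=\<close> 55)
  | Mean tm
  | Tru tm
  | Falsum
  | Conj fm fm  (infixr \<open>\<^bold>\<and>\<close> 45)
  | Disj fm fm  (infixr \<open>\<^bold>\<or>\<close> 40)
  | Impl fm fm  (infixr \<open>\<^bold>\<longrightarrow>\<close> 35)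
  | Forall fm
  | Exists fm

abbreviation Neg :: "fm \<Rightarrow> fm"  (\<open>\<^bold>\<not> _\<close> [50] 50)
  where "\<^bold>\<not> \<phi> \<equiv> \<phi> \<^bold>\<longrightarrow> Falsum"

abbreviation Iff :: "fm \<Rightarrow> fm \<Rightarrow> fm"  (infix \<open>\<^bold>\<longleftrightarrow>\<close> 34)
  where "\<phi> \<^bold>\<longleftrightarrow> \<psi> \<equiv> (\<phi> \<^bold>\<longrightarrow> \<psi>) \<^bold>\<and> (\<psi> \<^bold>\<longrightarrow> \<phi>)"

primrec subst_tm :: "(nat \<Rightarrow> tm) \<Rightarrow> tm \<Rightarrow> tm" where
  "subst_tm \<sigma> (Var i) = \<sigma> i"
| "subst_tm \<sigma> Zero = Zero"
| "subst_tm \<sigma> (Succ t) = Succ (subst_tm \<sigma> t)"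
| "subst_tm \<sigma> (Fn f ts) = Fn f (map (subst_tm \<sigma>) ts)"

definition lift_tm :: "tm \<Rightarrow> tm" where
  "lift_tm = subst_tm (\<lambda>i. Var (Suc i))"

definition lift_subst :: "(nat \<Rightarrow> tm) \<Rightarrow> nat \<Rightarrow> tm" where
  "lift_subst \<sigma> = case_nat (Var 0) (\<lambda>i. lift_tm (\<sigma> i))"

primrec subst_fm :: "(nat \<Rightarrow> tm) \<Rightarrow> fm \<Rightarrow> fm" where
  "subst_fm \<sigma> (s \<^bold>= t) = (subst_tm \<sigma> s \<^bold>= subst_tm \<sigma> t)"
| "subst_fm \<sigma> (Mean t) = Mean (subst_tm \<sigma> t)"
| "subst_fm \<sigma> (Tru t) = Tru (subst_tm \<sigma> t)"
| "subst_fm \<sigma> Falsum = Falsum"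
| "subst_fm \<sigma> (\<phi> \<^bold>\<and> \<psi>) = (subst_fm \<sigma> \<phi> \<^bold>\<and> subst_fm \<sigma> \<psi>)"
| "subst_fm \<sigma> (\<phi> \<^bold>\<or> \<psi>) = (subst_fm \<sigma> \<phi> \<^bold>\<or> subst_fm \<sigma> \<psi>)"
| "subst_fm \<sigma> (\<phi> \<^bold>\<longrightarrow> \<psi>) = (subst_fm \<sigma> \<phi> \<^bold>\<longrightarrow> subst_fm \<sigma> \<psi>)"
| "subst_fm \<sigma> (Forall \<phi>) = Forall (subst_fm (lift_subst \<sigma>) \<phi>)"
| "subst_fm \<sigma> (Exists \<phi>) = Exists (subst_fm (lift_subst \<sigma>) \<phi>)"

definition lift_fm :: "fm \<Rightarrow> fm" where
  "lift_fm = subst_fm (\<lambda>i. Var (Suc i))"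

text \<open>\<open>inst \<phi> t\<close> replaces index 0 by \<open>t\<close> and lowers the other indices, i.e. removes a quantifier.\<close>

definition inst :: "fm \<Rightarrow> tm \<Rightarrow> fm" where
  "inst \<phi> t = subst_fm (case_nat t Var) \<phi>"

text \<open>\<open>inst_Succ \<phi>\<close> is \<open>\<phi>(x + 1)\<close>, in the same free variables as \<open>\<phi>(x)\<close>, where \<open>x\<close> is index 0.\<close>

definition inst_Succ :: "fm \<Rightarrow> fm" where
  "inst_Succ \<phi> = subst_fm (case_nat (Succ (Var 0)) (\<lambda>i. Var (Suc i))) \<phi>"


section \<open>Provability in Heyting arithmetic\<close>

definition arg :: "nat \<Rightarrow> tm list \<Rightarrow> tm" where
  "arg i ts = (if i < length ts then ts ! i else Zero)"

text \<open>
  Intuitionistic natural deduction with equality, plus the defining equations of all primitive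
  recursive functions and induction for all formulas of the language, including those
  containing \<open>Mean\<close> and \<open>Tru\<close>.
\<close>

inductive prov :: "fm set \<Rightarrow> fm \<Rightarrow> bool"  (infix \<open>\<turnstile>\<close> 30) where
  assm: "\<phi> \<in> \<Gamma> \<Longrightarrow> \<Gamma> \<turnstile> \<phi>"
| FalsumE: "\<Gamma> \<turnstile> Falsum \<Longrightarrow> \<Gamma> \<turnstile> \<phi>"
| ConjI: "\<Gamma> \<turnstile> \<phi> \<Longrightarrow> \<Gamma> \<turnstile> \<psi> \<Longrightarrow> \<Gamma> \<turnstile> \<phi> \<^bold>\<and> \<psi>"
| ConjE1: "\<Gamma> \<turnstile> \<phi> \<^bold>\<and> \<psi> \<Longrightarrow> \<Gamma> \<turnstile> \<phi>"
| ConjE2: "\<Gamma> \<turnstile> \<phi> \<^bold>\<and> \<psi> \<Longrightarrow> \<Gamma> \<turnstile> \<psi>"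
| DisjI1: "\<Gamma> \<turnstile> \<phi> \<Longrightarrow> \<Gamma> \<turnstile> \<phi> \<^bold>\<or> \<psi>"
| DisjI2: "\<Gamma> \<turnstile> \<psi> \<Longrightarrow> \<Gamma> \<turnstile> \<phi> \<^bold>\<or> \<psi>"
| DisjE: "\<Gamma> \<turnstile> \<phi> \<^bold>\<or> \<psi> \<Longrightarrow> insert \<phi> \<Gamma> \<turnstile> \<chi> \<Longrightarrow> insert \<psi> \<Gamma> \<turnstile> \<chi> \<Longrightarrow> \<Gamma> \<turnstile> \<chi>"
| ImplI: "insert \<phi> \<Gamma> \<turnstile> \<psi> \<Longrightarrow> \<Gamma> \<turnstile> \<phi> \<^bold>\<longrightarrow> \<psi>"
| ImplE: "\<Gamma> \<turnstile> \<phi> \<^bold>\<longrightarrow> \<psi> \<Longrightarrow> \<Gamma> \<turnstile> \<phi> \<Longrightarrow> \<Gamma> \<turnstile> \<psi>"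
| AllI: "lift_fm ` \<Gamma> \<turnstile> \<phi> \<Longrightarrow> \<Gamma> \<turnstile> Forall \<phi>"
| AllE: "\<Gamma> \<turnstile> Forall \<phi> \<Longrightarrow> \<Gamma> \<turnstile> inst \<phi> t"
| ExI: "\<Gamma> \<turnstile> inst \<phi> t \<Longrightarrow> \<Gamma> \<turnstile> Exists \<phi>"
| ExE: "\<Gamma> \<turnstile> Exists \<phi> \<Longrightarrow> insert \<phi> (lift_fm ` \<Gamma>) \<turnstile> lift_fm \<psi> \<Longrightarrow> \<Gamma> \<turnstile> \<psi>"
| Eq_refl: "\<Gamma> \<turnstile> t \<^bold>= t"
| Eq_subst: "\<Gamma> \<turnstile> s \<^bold>= t \<Longrightarrow> \<Gamma> \<turnstile> inst \<phi> s \<Longrightarrow> \<Gamma> \<turnstile> inst \<phi> t"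
| Succ_not_Zero: "\<Gamma> \<turnstile> \<^bold>\<not> Succ t \<^bold>= Zero"
| Succ_inject: "\<Gamma> \<turnstile> Succ s \<^bold>= Succ t \<^bold>\<longrightarrow> s \<^bold>= t"
| induction: "\<Gamma> \<turnstile> inst \<phi> Zero \<Longrightarrow> \<Gamma> \<turnstile> Forall (\<phi> \<^bold>\<longrightarrow> inst_Succ \<phi>) \<Longrightarrow> \<Gamma> \<turnstile> Forall \<phi>"
| pr_Zero: "\<Gamma> \<turnstile> Fn PZero ts \<^bold>= Zero"
| pr_Succ: "\<Gamma> \<turnstile> Fn PSucc ts \<^bold>= Succ (arg 0 ts)"
| pr_Proj: "\<Gamma> \<turnstile> Fn (PProj i) ts \<^bold>= arg i ts"
| pr_Comp: "\<Gamma> \<turnstile> Fn (PComp f gs) ts \<^bold>= Fn f (map (\<lambda>g. Fn g ts) gs)"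
| pr_Rec_Nil: "\<Gamma> \<turnstile> Fn (PRec f g) [] \<^bold>= Fn f []"
| pr_Rec_Zero: "\<Gamma> \<turnstile> Fn (PRec f g) (Zero # ts) \<^bold>= Fn f ts"
| pr_Rec_Succ:
    "\<Gamma> \<turnstile> Fn (PRec f g) (Succ t # ts) \<^bold>= Fn g (Fn (PRec f g) (t # ts) # t # ts)"


section \<open>Some primitive recursive functions\<close>

definition pr_add :: prfun where
  "pr_add = PRec (PProj 0) (PComp PSucc [PProj 0])"

definition pr_pred :: prfun where
  "pr_pred = PRec PZero (PProj 1)"

text \<open>Truncated subtraction with swapped arguments: \<open>(y, x) \<mapsto> x - y\<close>.\<close>

definition pr_rsub :: prfun where
  "pr_rsub = PRec (PProj 0) (PComp pr_pred [PProj 0])"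

text \<open>\<open>(c, x, y) \<mapsto> x\<close> if \<open>c = 0\<close>, and \<open>y\<close> otherwise.\<close>

definition pr_ifz :: prfun where
  "pr_ifz = PRec (PProj 0) (PProj 3)"

definition pr_triangle :: prfun where
  "pr_triangle = PRec PZero (PComp pr_add [PProj 0, PComp PSucc [PProj 1]])"

text \<open>Cantor pairing, \<open>\<langle>x, y\<rangle> = (x + y)(x + y + 1)/2 + y\<close>.\<close>

definition pr_pair :: prfun where
  "pr_pair = PComp pr_add [PComp pr_triangle [PComp pr_add [PProj 0, PProj 1]], PProj 1]"

text \<open>The index of the diagonal containing \<open>n\<close>: the largest \<open>w\<close> with \<open>w(w + 1)/2 \<le> n\<close>.\<close>

definition pr_diag :: prfun where
  "pr_diag = PRec PZero
     (PComp pr_ifz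
       [PComp pr_rsub [PComp PSucc [PProj 1], PComp pr_triangle [PComp PSucc [PProj 0]]],
        PComp PSucc [PProj 0],
        PProj 0])"

definition pr_snd :: prfun where
  "pr_snd = PComp pr_rsub [PComp pr_triangle [pr_diag], PProj 0]"

definition pr_fst :: prfun where
  "pr_fst = PComp pr_rsub [pr_snd, pr_diag]"


section \<open>Kleene application\<close>

text \<open>
  The enumeration of the unary partial recursive functions is given by a universal stack machine
  whose programs are codes for the schemes of recursive function theory; the
  functions with index \<open>\<langle>tag, d\<rangle>\<close> are as follows; other tags index the empty function.

  \<^item> \<open>\<langle>0, c\<rangle>\<close>: constantly \<open>c\<close>
  \<^item> \<open>\<langle>1, _\<rangle>\<close>: successor
  \<^item> \<open>\<langle>2, _\<rangle>\<close> and \<open>\<langle>3, _\<rangle>\<close>: first and second projection of Cantor pairs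
  \<^item> \<open>\<langle>4, \<langle>a, b\<rangle>\<rangle>\<close>: composition \<open>v \<mapsto> a(b v)\<close>
  \<^item> \<open>\<langle>5, \<langle>a, b\<rangle>\<rangle>\<close>: pairing \<open>v \<mapsto> \<langle>a v, b v\<rangle>\<close>
  \<^item> \<open>\<langle>6, \<langle>a, b\<rangle>\<rangle>\<close>: primitive recursion, \<open>\<langle>0, p\<rangle> \<mapsto> a p\<close> and \<open>\<langle>k + 1, p\<rangle> \<mapsto> b \<langle>\<langle>k, p\<rangle>, r\<rangle>\<close>, where \<open>r\<close> is
    the value at \<open>\<langle>k, p\<rangle>\<close>
  \<^item> \<open>\<langle>7, a\<rangle>\<close>: minimisation, \<open>p \<mapsto>\<close> the least \<open>y\<close> with \<open>a \<langle>y, p\<rangle> = 0\<close>, where \<open>a \<langle>x, p\<rangle>\<close> must be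
    defined for all \<open>x < y\<close>
  \<^item> \<open>\<langle>8, x\<rangle>\<close>: \<open>v \<mapsto> \<langle>x, v\<rangle>\<close>
  \<^item> \<open>\<langle>9, \<langle>b, u\<rangle>\<rangle>\<close>: \<open>v \<mapsto> \<langle>v, b u\<rangle>\<close>
  \<^item> \<open>\<langle>10, \<langle>a, \<langle>y, p\<rangle>\<rangle>\<rangle>\<close>: \<open>0 \<mapsto> y\<close>, and \<open>v + 1 \<mapsto>\<close> the least \<open>x > y\<close> with \<open>a \<langle>x, p\<rangle> = 0\<close>, where \<open>a\<close> must be
    defined at the intermediate arguments

  The last three also serve as continuations of pairing, primitive recursion and minimisation.

  A state is \<open>\<langle>s, v\<rangle>\<close>, with \<open>v\<close> the current value and \<open>s\<close> the stack of indices that remain to be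
  applied to it; \<open>0\<close> is the empty stack, and \<open>\<langle>c, s\<rangle> + 1\<close> is \<open>s\<close> with \<open>c\<close> on top.
\<close>

abbreviation p_pair :: "prfun \<Rightarrow> prfun \<Rightarrow> prfun" where "p_pair f g \<equiv> PComp pr_pair [f, g]"
abbreviation p_fst :: "prfun \<Rightarrow> prfun" where "p_fst f \<equiv> PComp pr_fst [f]"
abbreviation p_snd :: "prfun \<Rightarrow> prfun" where "p_snd f \<equiv> PComp pr_snd [f]"
abbreviation p_succ :: "prfun \<Rightarrow> prfun" where "p_succ f \<equiv> PComp PSucc [f]"
abbreviation p_pred :: "prfun \<Rightarrow> prfun" where "p_pred f \<equiv> PComp pr_pred [f]"
abbreviation p_ifz :: "prfun \<Rightarrow> prfun \<Rightarrow> prfun \<Rightarrow> prfun" where "p_ifz f g h \<equiv> PComp pr_ifz [f, g, h]"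
abbreviation p_push :: "prfun \<Rightarrow> prfun \<Rightarrow> prfun" where "p_push c s \<equiv> p_succ (p_pair c s)"

primrec p_num :: "nat \<Rightarrow> prfun" where
  "p_num 0 = PZero"
| "p_num (Suc n) = p_succ (p_num n)"

fun p_switch :: "prfun \<Rightarrow> prfun list \<Rightarrow> prfun \<Rightarrow> prfun" where
  "p_switch t [] f = f"
| "p_switch t (g # gs) f = p_ifz t g (p_switch (p_pred t) gs f)"

text \<open>
  \<open>pr_exec\<close> has the arguments \<open>(tag, d, s, v)\<close> and yields the successor state of \<open>\<langle>s', v\<rangle>\<close>, where
  \<open>s'\<close> is \<open>s\<close> with \<open>\<langle>tag, d\<rangle>\<close> on top. For unused tags it yields a state with this same stack \<open>s'\<close>.
\<close>

definition pr_exec :: prfun where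
  "pr_exec =
    (let tag = PProj 0; d = PProj 1; s = PProj 2; v = PProj 3; self = p_pair tag d in
     p_switch tag
      [p_pair s d,
       p_pair s (p_succ v),
       p_pair s (p_fst v),
       p_pair s (p_snd v),
       p_pair (p_push (p_snd d) (p_push (p_fst d) s)) v,
       p_pair (p_push (p_fst d) (p_push (p_pair (p_num 9) (p_pair (p_snd d) v)) s)) v,
       p_ifz (p_fst v)
         (p_pair (p_push (p_fst d) s) (p_snd v))
         (let v' = p_pair (p_pred (p_fst v)) (p_snd v) in
          p_pair (p_push self (p_push (p_pair (p_num 8) v') (p_push (p_snd d) s))) v'),
       (let v' = p_pair PZero v in
        p_pair (p_push d (p_push (p_pair (p_num 10) (p_pair d v')) s)) v'),
       p_pair s (p_pair d v),
       p_pair (p_push (p_fst d) (p_push (p_pair (p_num 8) v) s)) (p_snd d),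
       p_ifz v
         (p_pair s (p_fst (p_snd d)))
         (let v' = p_pair (p_succ (p_fst (p_snd d))) (p_snd (p_snd d)) in
          p_pair (p_push (p_fst d) (p_push (p_pair (p_num 10) (p_pair (p_fst d) v')) s)) v')]
      (p_pair (p_push self s) v))"

definition pr_step :: prfun where
  "pr_step =
    (let s = p_fst (PProj 0); v = p_snd (PProj 0); c = p_fst (p_pred s) in
     p_ifz s (PProj 0) (PComp pr_exec [p_fst c, p_snd c, p_snd (p_pred s), v]))"

text \<open>\<open>(z, e, n) \<mapsto>\<close> the state after \<open>z\<close> steps of the computation of \<open>e\<close> on input \<open>n\<close>.\<close>

definition pr_run :: prfun where
  "pr_run = PRec (p_pair (p_push (PProj 0) PZero) (PProj 1)) (PComp pr_step [PProj 0])"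

abbreviation CPair :: "tm \<Rightarrow> tm \<Rightarrow> tm" where
  "CPair s t \<equiv> Fn pr_pair [s, t]"

text \<open>The formula \<open>e n \<simeq> y\<close>.\<close>

definition App :: "tm \<Rightarrow> tm \<Rightarrow> tm \<Rightarrow> fm" where
  "App e n y = Exists (Fn pr_run [Var 0, lift_tm e, lift_tm n] \<^bold>= CPair Zero (lift_tm y))"

text \<open>The formula \<open>e n \<down>\<close>.\<close>

definition Defined :: "tm \<Rightarrow> tm \<Rightarrow> fm" where
  "Defined e n = Exists (App (lift_tm e) (lift_tm n) (Var 0))"

text \<open>
  The formula \<open>P(e n)\<close> for the partial term \<open>e n\<close>, i.e. \<open>e n\<close> is defined and its value satisfies \<open>P\<close>;
  \<open>P\<close> is meant to be \<open>Mean\<close> or \<open>Tru\<close>.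
\<close>

definition At :: "(tm \<Rightarrow> fm) \<Rightarrow> tm \<Rightarrow> tm \<Rightarrow> fm" where
  "At P e n = Exists (App (lift_tm e) (lift_tm n) (Var 0) \<^bold>\<and> P (Var 0))"


section \<open>The axioms on meaningful and true conditions\<close>

text \<open>\<open>\<forall>f g f' g'. \<Xi>(f, g) = \<Xi>(f', g') \<longrightarrow> f = f' \<and> g = g'\<close>\<close>

definition Xi_injective :: "prfun \<Rightarrow> fm" where
  "Xi_injective Xi = Forall (Forall (Forall (Forall
     (Fn Xi [Var 3, Var 2] \<^bold>= Fn Xi [Var 1, Var 0]
        \<^bold>\<longrightarrow> Var 3 \<^bold>= Var 1 \<^bold>\<and> Var 2 \<^bold>= Var 0))))"

text \<open>In both axioms \<open>f\<close> and \<open>g\<close> are the indices 1 and 0, shifted to 2 and 1 below the quantifier over \<open>n\<close>.\<close>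

definition X1 :: "prfun \<Rightarrow> fm" where
  "X1 Xi = Forall (Forall
     (Mean (Fn Xi [Var 1, Var 0]) \<^bold>\<longrightarrow>
       (Tru (Fn Xi [Var 1, Var 0]) \<^bold>\<longleftrightarrow>
         Forall (Defined (Var 2) (Var 0) \<^bold>\<and> At Tru (Var 2) (Var 0)
                \<^bold>\<longrightarrow> Defined (Var 1) (Var 0) \<^bold>\<and> At Tru (Var 1) (Var 0)))))"

definition X2 :: "prfun \<Rightarrow> fm" where
  "X2 Xi = Forall (Forall
     (Forall (Defined (Var 2) (Var 0) \<^bold>\<longrightarrow> At Mean (Var 2) (Var 0))
      \<^bold>\<and> Forall (Defined (Var 2) (Var 0) \<^bold>\<and> Defined (Var 1) (Var 0) \<^bold>\<and> At Tru (Var 2) (Var 0)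
               \<^bold>\<longrightarrow> At Mean (Var 1) (Var 0))
      \<^bold>\<longrightarrow> Mean (Fn Xi [Var 1, Var 0])))"

definition Bottom :: fm where
  "Bottom = Exists (Mean (Var 0) \<^bold>\<and> \<^bold>\<not> Tru (Var 0))"

end

theory Submission
  imports Defs
begin

text \<open>
  Suppose \<open>\<mu>\<close> enumerates meaningfulness as excluded by the theorem. For every \<open>n\<close> the condition
  \<open>c(n) = \<Xi>(\<Lambda>m. \<mu>\<langle>n, m\<rangle>, \<Lambda>m. n)\<close> is meaningful: its antecedents are meaningful, and \<open>n\<close> is so as soon as one of
  them is true. Moreover \<open>c(n)\<close> is true iff the meaningfulness of \<open>n\<close> implies its truth. The second
  recursion theorem yields \<open>f\<close> such that \<open>f m = c(n)\<close> for all \<open>m\<close>, where \<open>n = \<Xi>(f, \<Lambda>m. \<bottom>)\<close>. As \<open>c(n)\<close> is meaningful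
  without assumptions on \<open>n\<close>, so is \<open>n\<close>, and then \<open>n\<close> is true iff \<open>c(n)\<close> is not, that is, iff \<open>n\<close> is not true.
\<close>

section \<open>Substitution and derived rules\<close>

text \<open>The direct liar, f m = n with n = \<Xi>(f, \<Lambda>m. \<bottom>), gets nowhere: X2
  gives the meaningfulness of n only after that of the values of f, which is n itself. Passing
  through c(n) breaks this circle. It uses the existential form of the enumeration: \<forall>m
  (T(\<mu>\<langle>n, m\<rangle>) \<longrightarrow> T(n)) is intuitionistically the same as
  \<exists>m T(\<mu>\<langle>n, m\<rangle>) \<longrightarrow> T(n). The final contradiction is
  constructive too: the truth of n is refuted, and this refutation makes the antecedent of n
  untenable, so n is true. The bulk of the work comes from the embedding. The claim is derivability
  in a calculus, and \<mu> and \<bottom> are variables there, released from existential quantifiers,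
  so no computation can be settled by evaluating numerals. Inversion of pairing, determinism of the
  machine and correctness of indices must all be derived inside arithmetic, uniformly for open
  terms. The recursion theorem then rests on indices of primitive recursive functions.\<close>

lemma lift_tm_simps [simp]:
  "lift_tm (Var i) = Var (Suc i)" "lift_tm Zero = Zero" "lift_tm (Succ t) = Succ (lift_tm t)"
  "lift_tm (Fn f ts) = Fn f (map lift_tm ts)"
  by (simp_all add: lift_tm_def)

lemma lift_subst_simps [simp]:
  "lift_subst \<sigma> 0 = Var 0" "lift_subst \<sigma> (Suc i) = lift_tm (\<sigma> i)"
  "lift_subst \<sigma> (numeral k) = lift_tm (\<sigma> (pred_numeral k))"
  by (simp_all add: lift_subst_def)

lemma subst_subst_tm: "subst_tm \<sigma> (subst_tm \<tau> t) = subst_tm (\<lambda>i. subst_tm \<sigma> (\<tau> i)) t"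
  by (induction t) auto

lemma subst_lift_tm [simp]: "subst_tm \<sigma> (lift_tm t) = subst_tm (\<lambda>i. \<sigma> (Suc i)) t"
  by (simp add: lift_tm_def subst_subst_tm)

lemma subst_tm_lift [simp]: "subst_tm (\<lambda>i. lift_tm (\<sigma> i)) t = lift_tm (subst_tm \<sigma> t)"
  by (simp add: lift_tm_def subst_subst_tm)

lemma subst_tm_Suc [simp]: "subst_tm (\<lambda>i. Var (Suc i)) t = lift_tm t"
  by (simp add: lift_tm_def)

lemma subst_tm_Suc_Suc [simp]:
  "subst_tm (\<lambda>i. Var (Suc (Suc i))) t = lift_tm (lift_tm t)"
  "subst_tm (\<lambda>i. Var (Suc (Suc (Suc i)))) t = lift_tm (lift_tm (lift_tm t))"
  by (simp_all only: lift_tm_def subst_subst_tm subst_tm.simps)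

lemma subst_tm_Var [simp]: "subst_tm Var t = t"
  by (induction t) (auto intro: map_idI)

lemma subst_lift_subst: "(\<lambda>i. subst_tm (lift_subst \<sigma>) (lift_subst \<tau> i)) = lift_subst (\<lambda>i. subst_tm \<sigma> (\<tau> i))"
proof
  fix i show "subst_tm (lift_subst \<sigma>) (lift_subst \<tau> i) = lift_subst (\<lambda>i. subst_tm \<sigma> (\<tau> i)) i"
    by (cases i) simp_all
qed

lemma subst_subst_fm: "subst_fm \<sigma> (subst_fm \<tau> \<phi>) = subst_fm (\<lambda>i. subst_tm \<sigma> (\<tau> i)) \<phi>"
  by (induction \<phi> arbitrary: \<sigma> \<tau>) (simp_all add: subst_subst_tm subst_lift_subst)

lemma subst_lift_fm [simp]: "subst_fm \<sigma> (lift_fm \<phi>) = subst_fm (\<lambda>i. \<sigma> (Suc i)) \<phi>"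
  by (simp add: lift_fm_def subst_subst_fm)

lemma lift_subst_fm: "lift_fm (subst_fm \<sigma> \<phi>) = subst_fm (\<lambda>i. lift_tm (\<sigma> i)) \<phi>"
  by (simp add: lift_fm_def subst_subst_fm)

lemma subst_inst: "subst_fm \<sigma> (inst \<phi> t) = inst (subst_fm (lift_subst \<sigma>) \<phi>) (subst_tm \<sigma> t)"
  unfolding inst_def subst_subst_fm
  by (rule arg_cong[where f = "\<lambda>\<sigma>. subst_fm \<sigma> \<phi>"]) (rule ext, simp add: lift_subst_def split: nat.split)

lemma subst_inst_Succ: "subst_fm (lift_subst \<sigma>) (inst_Succ \<phi>) = inst_Succ (subst_fm (lift_subst \<sigma>) \<phi>)"
  unfolding inst_Succ_def subst_subst_fm
  by (rule arg_cong[where f = "\<lambda>\<sigma>. subst_fm \<sigma> \<phi>"]) (rule ext, simp add: lift_subst_def split: nat.split)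

lemma subst_arg: "subst_tm \<sigma> (arg i ts) = arg i (map (subst_tm \<sigma>) ts)"
  by (simp add: arg_def)

section \<open>Structural properties of derivability\<close>

lemma weaken: "\<Gamma> \<turnstile> \<phi> \<Longrightarrow> \<Gamma> \<subseteq> \<Delta> \<Longrightarrow> \<Delta> \<turnstile> \<phi>"
proof (induction arbitrary: \<Delta> rule: prov.induct)
  case (DisjE \<Gamma> \<phi> \<psi> \<chi>)
  then show ?case by (meson prov.DisjE insert_mono)
next
  case (ImplI \<phi> \<Gamma> \<psi>)
  then show ?case by (meson prov.ImplI insert_mono)
next
  case (AllI \<Gamma> \<phi>)
  then show ?case by (meson prov.AllI image_mono)
next
  case (ExE \<Gamma> \<phi> \<psi>)
  then show ?case by (meson prov.ExE insert_mono image_mono)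
next
  case (ConjE1 \<Gamma> \<phi> \<psi>)
  then show ?case by (metis prov.ConjE1)
next
  case (ConjE2 \<Gamma> \<phi> \<psi>)
  then show ?case by (metis prov.ConjE2)
next
  case (ImplE \<Gamma> \<phi> \<psi>)
  then show ?case by (metis prov.ImplE)
next
  case (ExI \<Gamma> \<phi> t)
  then show ?case by (metis prov.ExI)
next
  case (Eq_subst \<Gamma> s t \<phi>)
  then show ?case by (metis prov.Eq_subst)
next
  case (FalsumE \<Gamma> \<phi>)
  then show ?case by (simp add: prov.FalsumE)
next
  case (AllE \<Gamma> \<phi> t)
  then show ?case by (simp add: prov.AllE)
next
  case (induction \<Gamma> \<phi>)
  then show ?case by (simp add: prov.induction)
qed (simp_all add: assm ConjI DisjI1 DisjI2 Eq_refl Succ_not_Zero Succ_inject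
  pr_Zero pr_Succ pr_Proj pr_Comp pr_Rec_Nil pr_Rec_Zero pr_Rec_Succ subset_iff)

lemma image_lift_subst: "lift_fm ` subst_fm \<sigma> ` \<Gamma> = subst_fm (lift_subst \<sigma>) ` lift_fm ` \<Gamma>"
  by (auto simp: image_image lift_subst_fm)

lemma prov_subst: "\<Gamma> \<turnstile> \<phi> \<Longrightarrow> subst_fm \<sigma> ` \<Gamma> \<turnstile> subst_fm \<sigma> \<phi>"
proof (induction arbitrary: \<sigma> rule: prov.induct)
  case (DisjE \<Gamma> \<phi> \<psi> \<chi>)
  then show ?case by (metis prov.DisjE image_insert subst_fm.simps(6))
next
  case (AllI \<Gamma> \<phi>)
  then show ?case by (simp add: prov.AllI image_lift_subst)
next
  case (AllE \<Gamma> \<phi> t)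
  then show ?case by (simp add: subst_inst prov.AllE)
next
  case (ExI \<Gamma> \<phi> t)
  then show ?case by (simp add: subst_inst) (metis prov.ExI)
next
  case (ExE \<Gamma> \<phi> \<psi>)
  from ExE.IH(2)[of "lift_subst \<sigma>"] show ?case
    by (intro prov.ExE[OF ExE.IH(1)[of \<sigma>, simplified]]) (simp add: image_lift_subst lift_subst_fm)
next
  case (Eq_subst \<Gamma> s t \<phi>)
  then show ?case by (simp add: subst_inst) (metis prov.Eq_subst)
next
  case (induction \<Gamma> \<phi>)
  then show ?case by (simp add: subst_inst subst_inst_Succ prov.induction)
next
  case (pr_Comp \<Gamma> f gs ts)
  then show ?case using prov.pr_Comp[of _ f gs "map (subst_tm \<sigma>) ts"] by (simp add: comp_def)
next
  case (ConjE1 \<Gamma> \<phi> \<psi>)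
  then show ?case by (metis prov.ConjE1 subst_fm.simps(5))
next
  case (ConjE2 \<Gamma> \<phi> \<psi>)
  then show ?case by (metis prov.ConjE2 subst_fm.simps(5))
next
  case (ImplE \<Gamma> \<phi> \<psi>)
  then show ?case by (metis prov.ImplE subst_fm.simps(7))
next
  case (FalsumE \<Gamma> \<phi>)
  then show ?case by (simp add: prov.FalsumE)
qed (simp_all add: subst_arg assm ConjI DisjI1 DisjI2 ImplI Eq_refl Succ_not_Zero Succ_inject
  pr_Zero pr_Succ pr_Proj pr_Rec_Nil pr_Rec_Zero pr_Rec_Succ)

lemma prov_lift: "\<Gamma> \<turnstile> \<phi> \<Longrightarrow> lift_fm ` \<Gamma> \<subseteq> \<Delta> \<Longrightarrow> \<Delta> \<turnstile> lift_fm \<phi>"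
  unfolding lift_fm_def by (meson prov_subst weaken)

text \<open>Quantifying over all extensions of the context, as in Kripke semantics, turns
  object-level assumptions into Isabelle assumptions about \<Delta>. Facts derived earlier follow
  along by \<open>weaken\<close> and \<open>prov_lift\<close>, so derivations can be written as
  ordinary structured proofs.\<close>

lemma AllI_context: "(\<And>\<Delta>. lift_fm ` \<Gamma> \<subseteq> \<Delta> \<Longrightarrow> \<Delta> \<turnstile> \<phi>) \<Longrightarrow> \<Gamma> \<turnstile> Forall \<phi>"
  by (simp add: AllI)

lemma ImplI_context: "(\<And>\<Delta>. \<Gamma> \<subseteq> \<Delta> \<Longrightarrow> \<Delta> \<turnstile> \<phi> \<Longrightarrow> \<Delta> \<turnstile> \<psi>) \<Longrightarrow> \<Gamma> \<turnstile> \<phi> \<^bold>\<longrightarrow> \<psi>"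
  by (rule ImplI) (simp add: assm subset_insertI)

lemma ExE_context:
  assumes "\<Gamma> \<turnstile> Exists \<phi>" and "\<And>\<Delta>. lift_fm ` \<Gamma> \<subseteq> \<Delta> \<Longrightarrow> \<Delta> \<turnstile> \<phi> \<Longrightarrow> \<Delta> \<turnstile> lift_fm \<psi>"
  shows "\<Gamma> \<turnstile> \<psi>"
  by (rule ExE[OF assms(1)]) (simp add: assms(2) assm subset_insertI)

lemma inst_simps [simp]:
  "inst (s \<^bold>= t) u = (subst_tm (case_nat u Var) s \<^bold>= subst_tm (case_nat u Var) t)"
  "inst (Mean t) u = Mean (subst_tm (case_nat u Var) t)"
  "inst (Tru t) u = Tru (subst_tm (case_nat u Var) t)"
  "inst Falsum u = Falsum"
  "inst (\<phi> \<^bold>\<and> \<psi>) u = (inst \<phi> u \<^bold>\<and> inst \<psi> u)"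
  "inst (\<phi> \<^bold>\<longrightarrow> \<psi>) u = (inst \<phi> u \<^bold>\<longrightarrow> inst \<psi> u)"
  by (simp_all add: inst_def)

lemma lift_fm_simps [simp]:
  "lift_fm (s \<^bold>= t) = (lift_tm s \<^bold>= lift_tm t)"
  "lift_fm (Mean t) = Mean (lift_tm t)"
  "lift_fm (Tru t) = Tru (lift_tm t)"
  "lift_fm Falsum = Falsum"
  "lift_fm (\<phi> \<^bold>\<and> \<psi>) = (lift_fm \<phi> \<^bold>\<and> lift_fm \<psi>)"
  "lift_fm (\<phi> \<^bold>\<longrightarrow> \<psi>) = (lift_fm \<phi> \<^bold>\<longrightarrow> lift_fm \<psi>)"
  by (simp_all add: lift_fm_def)

section \<open>Equational reasoning\<close>

lemma Eq_sym: "\<Gamma> \<turnstile> s \<^bold>= t \<Longrightarrow> \<Gamma> \<turnstile> t \<^bold>= s"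
  using Eq_subst[of \<Gamma> s t "Var 0 \<^bold>= lift_tm s"] by (simp add: Eq_refl)

lemma Eq_trans: "\<Gamma> \<turnstile> s \<^bold>= t \<Longrightarrow> \<Gamma> \<turnstile> t \<^bold>= u \<Longrightarrow> \<Gamma> \<turnstile> s \<^bold>= u"
  using Eq_subst[of \<Gamma> t u "lift_tm s \<^bold>= Var 0"] by simp

lemma Eq_Succ: "\<Gamma> \<turnstile> s \<^bold>= t \<Longrightarrow> \<Gamma> \<turnstile> Succ s \<^bold>= Succ t"
  using Eq_subst[of \<Gamma> s t "lift_tm (Succ s) \<^bold>= Succ (Var 0)"] by (simp add: Eq_refl)

text \<open>\<open>Eq_subst\<close> replaces one argument at a time. The induction walks through the
  list, and the prefix \<open>us\<close> of arguments already replaced is arbitrary because it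
  grows.\<close>

lemma Eq_Fn_aux:
  assumes "list_all2 (\<lambda>s t. \<Gamma> \<turnstile> s \<^bold>= t) ss ts"
  shows "\<Gamma> \<turnstile> Fn f (us @ ss) \<^bold>= Fn f (us @ ts)"
  using assms
proof (induction arbitrary: us rule: list_all2_induct)
  case Nil
  show ?case by (simp add: Eq_refl)
next
  case (Cons s ss t ts)
  have "\<Gamma> \<turnstile> Fn f (us @ s # ss) \<^bold>= Fn f (us @ t # ss)"
    using Eq_subst[OF Cons(1), of "lift_tm (Fn f (us @ s # ss)) \<^bold>= Fn f (map lift_tm us @ Var 0 # map lift_tm ss)"]
    by (simp add: Eq_refl comp_def)
  with Cons(3)[of "us @ [t]"] show ?case by (auto intro: Eq_trans)
qed

text \<open>
  \<open>nf \<Gamma>\<close> picks a representative of each class of \<open>\<Gamma>\<close>-provably equal terms, so that equality of \<open>nf \<Gamma>\<close>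
  values is provable equality and the simplifier can be used for equational reasoning in Heyting arithmetic.
\<close>

definition nf :: "fm set \<Rightarrow> tm \<Rightarrow> tm" where
  "nf \<Gamma> t = (SOME u. \<Gamma> \<turnstile> t \<^bold>= u)"

text \<open>These are the term constructors acting on representatives. As constants of their own
  they let \<open>nf\<close> be pushed to the leaves; with
  \<open>nf \<Gamma> (Succ (nf \<Gamma> t))\<close> on the right-hand side, the push rule would
  match its own result.\<close>

definition nf_Succ :: "fm set \<Rightarrow> tm \<Rightarrow> tm" where
  "nf_Succ \<Gamma> t = nf \<Gamma> (Succ t)"

definition nf_Fn :: "fm set \<Rightarrow> prfun \<Rightarrow> tm list \<Rightarrow> tm" where
  "nf_Fn \<Gamma> f ts = nf \<Gamma> (Fn f ts)"

lemma Eq_nf: "\<Gamma> \<turnstile> t \<^bold>= nf \<Gamma> t"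
  unfolding nf_def by (rule someI) (rule Eq_refl)

lemma prov_Eq_iff: "\<Gamma> \<turnstile> s \<^bold>= t \<longleftrightarrow> nf \<Gamma> s = nf \<Gamma> t"
proof
  assume "\<Gamma> \<turnstile> s \<^bold>= t"
  then have "(\<lambda>u. \<Gamma> \<turnstile> s \<^bold>= u) = (\<lambda>u. \<Gamma> \<turnstile> t \<^bold>= u)" by (blast intro: Eq_trans Eq_sym)
  then show "nf \<Gamma> s = nf \<Gamma> t" by (simp add: nf_def)
next
  assume "nf \<Gamma> s = nf \<Gamma> t"
  then show "\<Gamma> \<turnstile> s \<^bold>= t" by (metis Eq_nf Eq_trans Eq_sym)
qed

lemma nf_nf [simp]: "nf \<Gamma> (nf \<Gamma> t) = nf \<Gamma> t"
  by (simp add: prov_Eq_iff[symmetric] Eq_nf Eq_sym)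

lemma nf_Succ_push [simp]: "nf \<Gamma> (Succ t) = nf_Succ \<Gamma> (nf \<Gamma> t)"
  by (simp add: nf_Succ_def prov_Eq_iff[symmetric] Eq_nf Eq_Succ)

lemma nf_Fn_push [simp]: "nf \<Gamma> (Fn f ts) = nf_Fn \<Gamma> f (map (nf \<Gamma>) ts)"
  unfolding nf_Fn_def prov_Eq_iff[symmetric]
  using Eq_Fn_aux[of \<Gamma> ts "map (nf \<Gamma>) ts" f "[]"] by (simp add: list_all2_conv_all_nth Eq_nf)

lemma nf_nf_Succ [simp]: "nf \<Gamma> (nf_Succ \<Gamma> t) = nf_Succ \<Gamma> t"
  by (metis nf_Succ_def nf_nf)

lemma nf_nf_Fn [simp]: "nf \<Gamma> (nf_Fn \<Gamma> f ts) = nf_Fn \<Gamma> f ts"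
  by (metis nf_Fn_def nf_nf)

text \<open>It puts arguments that are bare variables under \<open>nf\<close>, which brings a goal
  into the shape of a pushed equation. As a rewrite rule it would loop, so it is applied by single
  substitutions.\<close>

lemma nf_Fn_normalise: "nf_Fn \<Gamma> f ts = nf_Fn \<Gamma> f (map (nf \<Gamma>) ts)"
  by (metis nf_Fn_def nf_Fn_push)

lemma nf_Succ_normalise: "nf_Succ \<Gamma> t = nf_Succ \<Gamma> (nf \<Gamma> t)"
  by (metis nf_Succ_def nf_Succ_push)

lemma nf_Fn_PZero [simp]: "nf_Fn \<Gamma> PZero ts = nf \<Gamma> Zero"
  unfolding nf_Fn_def prov_Eq_iff[symmetric] by (rule pr_Zero)

lemma nf_Fn_PSucc [simp]: "nf_Fn \<Gamma> PSucc ts = nf_Succ \<Gamma> (nf \<Gamma> (arg 0 ts))"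
  unfolding nf_Fn_def nf_Succ_push[symmetric] prov_Eq_iff[symmetric] by (rule pr_Succ)

lemma nf_Fn_PProj [simp]: "nf_Fn \<Gamma> (PProj i) ts = nf \<Gamma> (arg i ts)"
  unfolding nf_Fn_def prov_Eq_iff[symmetric] by (rule pr_Proj)

lemma nf_Fn_PComp [simp]: "nf_Fn \<Gamma> (PComp f gs) ts = nf_Fn \<Gamma> f (map (\<lambda>g. nf_Fn \<Gamma> g ts) gs)"
proof -
  have "nf \<Gamma> (Fn (PComp f gs) ts) = nf \<Gamma> (Fn f (map (\<lambda>g. Fn g ts) gs))"
    unfolding prov_Eq_iff[symmetric] by (rule pr_Comp)
  also have "\<dots> = nf_Fn \<Gamma> f (map (\<lambda>g. nf_Fn \<Gamma> g ts) gs)"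
    by (simp add: comp_def nf_Fn_normalise[symmetric])
  finally show ?thesis by (simp only: nf_Fn_def)
qed

lemma nf_Fn_PRec_Nil: "nf_Fn \<Gamma> (PRec f g) [] = nf_Fn \<Gamma> f []"
  unfolding nf_Fn_def prov_Eq_iff[symmetric] by (rule pr_Rec_Nil)

lemma nf_Fn_PRec_Zero: "nf_Fn \<Gamma> (PRec f g) (nf \<Gamma> Zero # ts) = nf_Fn \<Gamma> f ts"
  using pr_Rec_Zero[of \<Gamma> f g ts] unfolding prov_Eq_iff
  by (simp add: nf_Fn_normalise[symmetric]) (subst nf_Fn_normalise, simp)

lemma nf_Fn_PRec_Succ:
  "nf_Fn \<Gamma> (PRec f g) (nf_Succ \<Gamma> t # ts) = nf_Fn \<Gamma> g (nf_Fn \<Gamma> (PRec f g) (t # ts) # t # ts)"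
  using pr_Rec_Succ[of \<Gamma> f g t ts] unfolding prov_Eq_iff
  by (subst (1 2 3) nf_Fn_normalise) (simp add: nf_Succ_normalise[symmetric])

lemma arg_Cons [simp]:
  "arg 0 (t # ts) = t" "arg (Suc i) (t # ts) = arg i ts" "arg (numeral k) (t # ts) = arg (pred_numeral k) ts"
  "arg i [] = Zero"
  by (simp_all add: arg_def numeral_eq_Suc)

text \<open>The step is demanded for an arbitrary context \<Delta>, unrelated to \<Gamma>, so an
  induction formula has to carry every hypothesis that its step uses.\<close>

lemma prov_induct:
  assumes "\<Gamma> \<turnstile> inst \<phi> Zero" and "\<And>\<Delta>. \<Delta> \<turnstile> \<phi> \<Longrightarrow> \<Delta> \<turnstile> inst_Succ \<phi>"
  shows "\<Gamma> \<turnstile> inst \<phi> t"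
  by (rule AllE, rule induction, rule assms(1), rule AllI, rule ImplI, rule assms(2), rule assm, simp)

lemma nf_induct:
  assumes "\<Gamma> \<turnstile> inst (s \<^bold>= t) Zero" and "\<And>\<Delta>. nf \<Delta> s = nf \<Delta> t \<Longrightarrow> \<Delta> \<turnstile> inst_Succ (s \<^bold>= t)"
  shows "nf \<Gamma> (subst_tm (case_nat u Var) s) = nf \<Gamma> (subst_tm (case_nat u Var) t)"
  using prov_induct[of \<Gamma> "s \<^bold>= t" u] assms by (simp add: prov_Eq_iff)

lemma inst_Succ_simps [simp]:
  "inst_Succ (s \<^bold>= t) = (subst_tm (case_nat (Succ (Var 0)) (\<lambda>i. Var (Suc i))) s \<^bold>= subst_tm (case_nat (Succ (Var 0)) (\<lambda>i. Var (Suc i))) t)"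
  by (simp add: inst_Succ_def)

section \<open>Arithmetic\<close>

lemma add_Zero [simp]: "nf_Fn \<Gamma> pr_add [nf \<Gamma> Zero, t] = nf \<Gamma> t"
  by (simp add: pr_add_def nf_Fn_PRec_Zero)

lemma add_Succ [simp]: "nf_Fn \<Gamma> pr_add [nf_Succ \<Gamma> s, t] = nf_Succ \<Gamma> (nf_Fn \<Gamma> pr_add [s, t])"
  by (simp add: pr_add_def nf_Fn_PRec_Succ)

lemma add_Zero_right [simp]: "nf_Fn \<Gamma> pr_add [t, nf \<Gamma> Zero] = nf \<Gamma> t"
  using nf_induct[of \<Gamma> "Fn pr_add [Var 0, Zero]" "Var 0" t]
  by (subst nf_Fn_normalise) (simp add: prov_Eq_iff)

lemma add_Succ_right [simp]: "nf_Fn \<Gamma> pr_add [s, nf_Succ \<Gamma> t] = nf_Succ \<Gamma> (nf_Fn \<Gamma> pr_add [s, t])"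
  using nf_induct[of \<Gamma> "Fn pr_add [Var 0, Succ (lift_tm t)]" "Succ (Fn pr_add [Var 0, lift_tm t])" s]
  by (subst (1 2) nf_Fn_normalise, subst nf_Succ_normalise) (simp add: prov_Eq_iff)

lemma add_commute: "nf_Fn \<Gamma> pr_add [s, t] = nf_Fn \<Gamma> pr_add [t, s]"
  using nf_induct[of \<Gamma> "Fn pr_add [Var 0, lift_tm t]" "Fn pr_add [lift_tm t, Var 0]" s]
  by (subst (1 2) nf_Fn_normalise) (simp add: prov_Eq_iff)

lemma add_assoc: "nf_Fn \<Gamma> pr_add [nf_Fn \<Gamma> pr_add [s, t], u] = nf_Fn \<Gamma> pr_add [s, nf_Fn \<Gamma> pr_add [t, u]]"
  using nf_induct[of \<Gamma> "Fn pr_add [Fn pr_add [Var 0, lift_tm t], lift_tm u]"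
      "Fn pr_add [Var 0, Fn pr_add [lift_tm t, lift_tm u]]" s]
  by (subst (1 2 3 4) nf_Fn_normalise) (simp add: prov_Eq_iff)

lemma pred_simps [simp]:
  "nf_Fn \<Gamma> pr_pred [nf \<Gamma> Zero] = nf \<Gamma> Zero" "nf_Fn \<Gamma> pr_pred [nf_Succ \<Gamma> t] = nf \<Gamma> t"
  by (simp_all add: pr_pred_def nf_Fn_PRec_Zero nf_Fn_PRec_Succ)

lemma ifz_simps [simp]:
  "nf_Fn \<Gamma> pr_ifz [nf \<Gamma> Zero, s, t] = nf \<Gamma> s" "nf_Fn \<Gamma> pr_ifz [nf_Succ \<Gamma> c, s, t] = nf \<Gamma> t"
  by (simp_all add: pr_ifz_def nf_Fn_PRec_Zero nf_Fn_PRec_Succ)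

lemma rsub_Zero [simp]: "nf_Fn \<Gamma> pr_rsub [nf \<Gamma> Zero, t] = nf \<Gamma> t"
  by (simp add: pr_rsub_def nf_Fn_PRec_Zero)

lemma rsub_Succ: "nf_Fn \<Gamma> pr_rsub [nf_Succ \<Gamma> s, t] = nf_Fn \<Gamma> pr_pred [nf_Fn \<Gamma> pr_rsub [s, t]]"
  by (simp add: pr_rsub_def nf_Fn_PRec_Succ)

lemma rsub_Succ_Succ [simp]: "nf_Fn \<Gamma> pr_rsub [nf_Succ \<Gamma> s, nf_Succ \<Gamma> t] = nf_Fn \<Gamma> pr_rsub [s, t]"
  using nf_induct[of \<Gamma> "Fn pr_pred [Fn pr_rsub [Var 0, Succ (lift_tm t)]]" "Fn pr_rsub [Var 0, lift_tm t]" s]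
  unfolding rsub_Succ
  by (subst (1 2 3) nf_Fn_normalise, subst nf_Succ_normalise) (simp add: prov_Eq_iff rsub_Succ)

lemma rsub_add [simp]: "nf_Fn \<Gamma> pr_rsub [s, nf_Fn \<Gamma> pr_add [s, t]] = nf \<Gamma> t"
  using nf_induct[of \<Gamma> "Fn pr_rsub [Var 0, Fn pr_add [Var 0, lift_tm t]]" "lift_tm t" s]
  by (subst (1 2) nf_Fn_normalise) (simp add: prov_Eq_iff)

lemma rsub_add' [simp]: "nf_Fn \<Gamma> pr_rsub [s, nf_Fn \<Gamma> pr_add [t, s]] = nf \<Gamma> t"
  by (subst add_commute) simp

section \<open>Triangular numbers, diagonals and the inversion of Cantor pairing\<close>

lemma triangle_simps [simp]:
  "nf_Fn \<Gamma> pr_triangle [nf \<Gamma> Zero] = nf \<Gamma> Zero"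
  "nf_Fn \<Gamma> pr_triangle [nf_Succ \<Gamma> t] = nf_Fn \<Gamma> pr_add [nf_Fn \<Gamma> pr_triangle [t], nf_Succ \<Gamma> (nf \<Gamma> t)]"
  by (simp_all add: pr_triangle_def nf_Fn_PRec_Zero nf_Fn_PRec_Succ)

lemma pair_eq:
  "nf_Fn \<Gamma> pr_pair [s, t] = nf_Fn \<Gamma> pr_add [nf_Fn \<Gamma> pr_triangle [nf_Fn \<Gamma> pr_add [s, t]], nf \<Gamma> t]"
  by (simp add: pr_pair_def) (subst (1) nf_Fn_normalise, simp)

lemma diag_Zero [simp]: "nf_Fn \<Gamma> pr_diag [nf \<Gamma> Zero] = nf \<Gamma> Zero"
  by (simp add: pr_diag_def nf_Fn_PRec_Zero)

lemma diag_Succ: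
  "nf_Fn \<Gamma> pr_diag [nf_Succ \<Gamma> t] =
    (let w = nf_Fn \<Gamma> pr_diag [t] in
     nf_Fn \<Gamma> pr_ifz [nf_Fn \<Gamma> pr_rsub [nf_Succ \<Gamma> (nf \<Gamma> t), nf_Fn \<Gamma> pr_triangle [nf_Succ \<Gamma> w]], nf_Succ \<Gamma> w, w])"
  by (simp add: pr_diag_def nf_Fn_PRec_Succ Let_def)

lemma rsub_add_same [simp]:
  "nf_Fn \<Gamma> pr_rsub [nf_Fn \<Gamma> pr_add [u, s], nf_Fn \<Gamma> pr_add [u, nf_Fn \<Gamma> pr_add [s, t]]] = nf \<Gamma> t"
  by (simp flip: add_assoc)

lemma rsub_add_same' [simp]:
  "nf_Fn \<Gamma> pr_rsub [nf_Fn \<Gamma> pr_add [u, s], nf_Fn \<Gamma> pr_add [u, nf_Fn \<Gamma> pr_add [t, s]]] = nf \<Gamma> t"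
  by (subst (3) add_commute) simp

lemma rsub_self [simp]: "nf_Fn \<Gamma> pr_rsub [t, t] = nf \<Gamma> Zero"
  using rsub_add[of \<Gamma> "nf \<Gamma> t" "nf \<Gamma> Zero"] by (subst nf_Fn_normalise) simp

text \<open>Diagonal w has the positions 0 to w, and w = x + 1 + y says that y is not the last one.
  The next triangular number exceeds the successor of the current number by x + 1, which is nonzero,
  so the test in \<open>pr_diag\<close> keeps w.\<close>

lemma diag_step:
  assumes "nf_Fn \<Gamma> pr_diag [nf_Fn \<Gamma> pr_add [nf_Fn \<Gamma> pr_triangle [w], y]] = w"
    and w: "w = nf_Fn \<Gamma> pr_add [nf_Succ \<Gamma> x, y]"
  shows "nf_Fn \<Gamma> pr_diag [nf_Succ \<Gamma> (nf_Fn \<Gamma> pr_add [nf_Fn \<Gamma> pr_triangle [w], y])] = w"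
proof -
  have "nf_Fn \<Gamma> pr_rsub [nf_Fn \<Gamma> pr_add [nf_Fn \<Gamma> pr_triangle [w], y], nf_Fn \<Gamma> pr_add [nf_Fn \<Gamma> pr_triangle [w], w]]
      = nf_Succ \<Gamma> x"
    \<comment> \<open>Only the last w is expanded, and \<open>add_Succ\<close> is switched off, so
      that the summands keep the shape which \<open>rsub_add_same'\<close> cancels.\<close>
    by (subst (3) w) (simp del: add_Succ)
  moreover have "nf \<Gamma> w = w" by (simp add: w)
  ultimately show ?thesis
    by (simp add: diag_Succ Let_def assms(1))
qed

text \<open>With w = x + y: if \<open>pr_diag\<close> is right at the start of diagonal w, then it
  is right at position y. The condition separates the induction along one diagonal from the
  induction over diagonals in \<open>diag_triangle\<close>, which relies on the former.\<close>

definition diag_claim :: "tm \<Rightarrow> tm \<Rightarrow> fm" where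
  "diag_claim x y =
    (Fn pr_diag [Fn pr_triangle [Fn pr_add [x, y]]] \<^bold>= Fn pr_add [x, y]
     \<^bold>\<longrightarrow> Fn pr_diag [Fn pr_add [Fn pr_triangle [Fn pr_add [x, y]], y]] \<^bold>= Fn pr_add [x, y])"

lemma subst_diag_claim [simp]: "subst_fm \<sigma> (diag_claim x y) = diag_claim (subst_tm \<sigma> x) (subst_tm \<sigma> y)"
  by (simp add: diag_claim_def)

lemma diag_claim: "\<Gamma> \<turnstile> diag_claim x y"
proof -
  \<comment> \<open>Induction on y; x is quantified inside the formula because it changes in the
    step.\<close>
  have "\<Gamma> \<turnstile> inst (Forall (diag_claim (Var 0) (Var 1))) y"
  proof (rule prov_induct)
    have "\<Delta> \<turnstile> diag_claim (Var 0) Zero" for \<Delta>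
      unfolding diag_claim_def by (rule ImplI_context) (simp add: prov_Eq_iff)
    then show "\<Gamma> \<turnstile> inst (Forall (diag_claim (Var 0) (Var 1))) Zero"
      by (simp add: inst_def AllI)
  next
    fix \<Delta> assume *: "\<Delta> \<turnstile> Forall (diag_claim (Var 0) (Var 1))"
    have "\<Delta>' \<turnstile> diag_claim (Var 0) (Succ (Var 1))" if "lift_fm ` \<Delta> \<subseteq> \<Delta>'" for \<Delta>'
    proof -
      have "\<Delta>' \<turnstile> Forall (diag_claim (Var 0) (Var 2))"
        using prov_lift[OF * that] by (simp add: lift_fm_def numeral_2_eq_2)
      \<comment> \<open>Moving from y to y + 1 on the same diagonal lowers x by one: x + (y + 1) =
        (x + 1) + y.\<close>
      from AllE[OF this, of "Succ (Var 0)"] have IH: "\<Delta>' \<turnstile> diag_claim (Succ (Var 0)) (Var 1)"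
        by (simp add: inst_def)
      show ?thesis
        unfolding diag_claim_def
      proof (rule ImplI_context)
        fix D
        assume "\<Delta>' \<subseteq> D"
          and h: "D \<turnstile> Fn pr_diag [Fn pr_triangle [Fn pr_add [Var 0, Succ (Var 1)]]] \<^bold>= Fn pr_add [Var 0, Succ (Var 1)]"
        with IH have "D \<turnstile> diag_claim (Succ (Var 0)) (Var 1)" by (blast intro: weaken)
        from this[unfolded diag_claim_def, THEN ImplE] h
        show "D \<turnstile> Fn pr_diag [Fn pr_add [Fn pr_triangle [Fn pr_add [Var 0, Succ (Var 1)]], Succ (Var 1)]]
            \<^bold>= Fn pr_add [Var 0, Succ (Var 1)]"
          using diag_step[of D "nf D (Fn pr_add [Succ (Var 0), Var 1])" "nf D (Var 1)" "nf D (Var 0)"]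
          by (simp add: prov_Eq_iff del: triangle_simps)
      qed
    qed
    then show "\<Delta> \<turnstile> inst_Succ (Forall (diag_claim (Var 0) (Var 1)))"
      by (simp add: inst_Succ_def AllI_context)
  qed
  then have "\<Gamma> \<turnstile> Forall (diag_claim (Var 0) (lift_tm y))" by (simp add: inst_def)
  from AllE[OF this, of x] show ?thesis by (simp add: inst_def)
qed

text \<open>Induction over diagonals. The instance x = 0, y = w of the claim reaches the last
  position of diagonal w. The successor of that number is the next triangular number, where the test
  becomes zero and the diagonal index increases.\<close>

lemma diag_triangle: "nf_Fn \<Gamma> pr_diag [nf_Fn \<Gamma> pr_triangle [t]] = nf \<Gamma> t"
proof -
  have "nf \<Gamma> (subst_tm (case_nat t Var) (Fn pr_diag [Fn pr_triangle [Var 0]])) = nf \<Gamma> (subst_tm (case_nat t Var) (Var 0))"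
  proof (rule nf_induct)
    fix \<Delta> assume "nf \<Delta> (Fn pr_diag [Fn pr_triangle [Var 0]]) = nf \<Delta> (Var 0)"
    then show "\<Delta> \<turnstile> inst_Succ (Fn pr_diag [Fn pr_triangle [Var 0]] \<^bold>= Var 0)"
      using diag_claim[of \<Delta> Zero "Var 0", unfolded diag_claim_def, THEN ImplE]
      by (simp add: prov_Eq_iff diag_Succ Let_def)
  qed (simp add: prov_Eq_iff)
  then show ?thesis by (subst (1 2) nf_Fn_normalise) simp
qed

lemma diag_pair [simp]: "nf_Fn \<Gamma> pr_diag [nf_Fn \<Gamma> pr_pair [s, t]] = nf_Fn \<Gamma> pr_add [s, t]"
  using diag_claim[of \<Gamma> s t, unfolded diag_claim_def, THEN ImplE]
  by (subst (1 2 3) nf_Fn_normalise) (simp add: prov_Eq_iff pair_eq diag_triangle)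

lemma snd_pair [simp]: "nf_Fn \<Gamma> pr_snd [nf_Fn \<Gamma> pr_pair [s, t]] = nf \<Gamma> t"
  by (simp add: pr_snd_def) (simp add: pair_eq)

lemma fst_pair [simp]: "nf_Fn \<Gamma> pr_fst [nf_Fn \<Gamma> pr_pair [s, t]] = nf \<Gamma> s"
  by (simp add: pr_fst_def) (subst (2) nf_Fn_normalise, simp)

lemma pair_Zero_Zero [simp]: "nf_Fn \<Gamma> pr_pair [nf \<Gamma> Zero, nf \<Gamma> Zero] = nf \<Gamma> Zero"
  by (simp add: pair_eq)

section \<open>Computations\<close>

primrec num :: "nat \<Rightarrow> tm" where
  "num 0 = Zero"
| "num (Suc n) = Succ (num n)"

lemma num_numeral: "num (numeral k) = Succ (num (pred_numeral k))"
  by (simp add: numeral_eq_Suc)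

lemma subst_num [simp]: "subst_tm \<sigma> (num n) = num n"
  by (induction n) simp_all

lemma lift_num [simp]: "lift_tm (num n) = num n"
  by (induction n) simp_all

lemma nf_Fn_p_num [simp]: "nf_Fn \<Gamma> (p_num n) ts = nf \<Gamma> (num n)"
  by (induction n) simp_all

declare num.simps [simp del]

section \<open>Runs of the machine and reachability of states\<close>

abbreviation Push :: "tm \<Rightarrow> tm \<Rightarrow> tm" where
  "Push c s \<equiv> Succ (CPair c s)"

text \<open>\<open>pr_run\<close> always starts with a single index on the stack. Iteration from an
  arbitrary state makes runs composable, with step counts adding up.\<close>

definition pr_iter :: prfun where
  "pr_iter = PRec (PProj 0) (PComp pr_step [PProj 0])"

lemma iter_simps [simp]:
  "nf_Fn \<Gamma> pr_iter [nf \<Gamma> Zero, a] = nf \<Gamma> a"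
  "nf_Fn \<Gamma> pr_iter [nf_Succ \<Gamma> z, a] = nf_Fn \<Gamma> pr_step [nf_Fn \<Gamma> pr_iter [z, a]]"
  by (simp_all add: pr_iter_def nf_Fn_PRec_Zero nf_Fn_PRec_Succ)

lemma iter_add: "nf_Fn \<Gamma> pr_iter [nf_Fn \<Gamma> pr_add [y, z], a] = nf_Fn \<Gamma> pr_iter [y, nf_Fn \<Gamma> pr_iter [z, a]]"
  using nf_induct[of \<Gamma> "Fn pr_iter [Fn pr_add [Var 0, lift_tm z], lift_tm a]"
      "Fn pr_iter [Var 0, Fn pr_iter [lift_tm z, lift_tm a]]" y]
  by (subst (1 2 3 4) nf_Fn_normalise) (simp add: prov_Eq_iff)

lemma run_eq_iter:
  "nf_Fn \<Gamma> pr_run [z, e, n] =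
    nf_Fn \<Gamma> pr_iter [z, nf_Fn \<Gamma> pr_pair [nf_Succ \<Gamma> (nf_Fn \<Gamma> pr_pair [nf \<Gamma> e, nf \<Gamma> Zero]), nf \<Gamma> n]]"
  using nf_induct[of \<Gamma> "Fn pr_run [Var 0, lift_tm e, lift_tm n]"
      "Fn pr_iter [Var 0, CPair (Push (lift_tm e) Zero) (lift_tm n)]" z]
  by (subst (1 2) nf_Fn_normalise) (simp add: prov_Eq_iff pr_run_def nf_Fn_PRec_Zero nf_Fn_PRec_Succ)

lemma step_halted [simp]:
  "nf_Fn \<Gamma> pr_step [nf_Fn \<Gamma> pr_pair [nf \<Gamma> Zero, v]] = nf_Fn \<Gamma> pr_pair [nf \<Gamma> Zero, v]"
  by (simp add: pr_step_def Let_def)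

lemma iter_halted [simp]:
  "nf_Fn \<Gamma> pr_iter [z, nf_Fn \<Gamma> pr_pair [nf \<Gamma> Zero, v]] = nf_Fn \<Gamma> pr_pair [nf \<Gamma> Zero, v]"
  using nf_induct[of \<Gamma> "Fn pr_iter [Var 0, CPair Zero (lift_tm v)]" "CPair Zero (lift_tm v)" z]
  by (subst (1 2 3) nf_Fn_normalise) (simp add: prov_Eq_iff)

lemma step_push:
  "nf_Fn \<Gamma> pr_step [nf_Fn \<Gamma> pr_pair [nf_Succ \<Gamma> (nf_Fn \<Gamma> pr_pair [nf_Fn \<Gamma> pr_pair [k, d], s]), v]] =
    nf_Fn \<Gamma> pr_exec [nf \<Gamma> k, nf \<Gamma> d, nf \<Gamma> s, nf \<Gamma> v]"
  by (simp add: pr_step_def Let_def)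

definition Reach :: "tm \<Rightarrow> tm \<Rightarrow> fm" where
  "Reach a b = Exists (Fn pr_iter [Var 0, lift_tm a] \<^bold>= lift_tm b)"

lemma subst_Reach [simp]: "subst_fm \<sigma> (Reach a b) = Reach (subst_tm \<sigma> a) (subst_tm \<sigma> b)"
  by (simp add: Reach_def)

lemma lift_Reach [simp]: "lift_fm (Reach a b) = Reach (lift_tm a) (lift_tm b)"
  by (simp add: lift_fm_def)

lemma inst_Reach [simp]: "inst (Reach a b) t = Reach (subst_tm (case_nat t Var) a) (subst_tm (case_nat t Var) b)"
  by (simp add: inst_def)

lemma ReachI: "nf_Fn \<Gamma> pr_iter [z, a] = nf \<Gamma> b \<Longrightarrow> \<Gamma> \<turnstile> Reach a b"
  unfolding Reach_def
  by (rule ExI[of _ _ z], simp add: prov_Eq_iff) (subst (asm) nf_Fn_normalise, simp)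

lemma Reach_eq: "nf \<Gamma> a = nf \<Gamma> b \<Longrightarrow> \<Gamma> \<turnstile> Reach a b"
  by (rule ReachI[of _ "nf \<Gamma> Zero"]) simp

lemma Reach_step: "nf \<Gamma> (Fn pr_step [a]) = nf \<Gamma> b \<Longrightarrow> \<Gamma> \<turnstile> Reach a b"
  by (rule ReachI[of _ "nf_Succ \<Gamma> (nf \<Gamma> Zero)"]) simp

lemma ReachE:
  assumes "\<Gamma> \<turnstile> Reach a b"
    and "\<And>\<Delta> z. lift_fm ` \<Gamma> \<subseteq> \<Delta> \<Longrightarrow>
      nf_Fn \<Delta> pr_iter [nf \<Delta> z, nf \<Delta> (lift_tm a)] = nf \<Delta> (lift_tm b) \<Longrightarrow> \<Delta> \<turnstile> lift_fm \<phi>"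
  shows "\<Gamma> \<turnstile> \<phi>"
  by (rule ExE_context[OF assms(1)[unfolded Reach_def]], rule assms(2)) (simp_all add: prov_Eq_iff)

lemma Reach_trans [trans]:
  assumes "\<Gamma> \<turnstile> Reach a b" and bc: "\<Gamma> \<turnstile> Reach b c"
  shows "\<Gamma> \<turnstile> Reach a c"
proof (rule ReachE[OF assms(1)])
  fix \<Delta> y
  assume \<Delta>: "lift_fm ` \<Gamma> \<subseteq> \<Delta>" and y: "nf_Fn \<Delta> pr_iter [nf \<Delta> y, nf \<Delta> (lift_tm a)] = nf \<Delta> (lift_tm b)"
  have "\<Delta> \<turnstile> Reach (lift_tm b) (lift_tm c)"
    using prov_lift[OF bc \<Delta>] by simp
  then have "\<Delta> \<turnstile> Reach (lift_tm a) (lift_tm c)"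
  proof (rule ReachE)
    fix D z
    assume "lift_fm ` \<Delta> \<subseteq> D" and z: "nf_Fn D pr_iter [nf D z, nf D (lift_tm (lift_tm b))] = nf D (lift_tm (lift_tm c))"
    moreover from y have "\<Delta> \<turnstile> Fn pr_iter [y, lift_tm a] \<^bold>= lift_tm b"
      by (simp add: prov_Eq_iff)
    ultimately have "D \<turnstile> lift_fm (Fn pr_iter [y, lift_tm a] \<^bold>= lift_tm b)"
      by (blast intro: prov_lift)
    then have "nf_Fn D pr_iter [nf_Fn D pr_add [nf D z, nf D (lift_tm y)], nf D (lift_tm (lift_tm a))] = nf D (lift_tm (lift_tm c))"
      by (simp add: iter_add prov_Eq_iff z)
    then show "D \<turnstile> lift_fm (Reach (lift_tm a) (lift_tm c))"
      by simp (rule ReachI[of _ "nf_Fn D pr_add [nf D z, nf D (lift_tm y)]"], subst nf_Fn_normalise, simp)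
  qed
  then show "\<Delta> \<turnstile> lift_fm (Reach a c)" by simp
qed

text \<open>Determinism without deciding which run is longer. If y steps lead from a to b and z
  steps to the halted state, then z further steps from b amount to y + z steps from a; taking the z
  steps first shows that these end in the halted state, which is a fixed point of the step
  function.\<close>

lemma Reach_halted_unique:
  assumes "\<Gamma> \<turnstile> Reach a b" and ac: "\<Gamma> \<turnstile> Reach a (CPair Zero v)"
  shows "\<Gamma> \<turnstile> Reach b (CPair Zero v)"
proof (rule ReachE[OF assms(1)])
  fix \<Delta> y
  assume \<Delta>: "lift_fm ` \<Gamma> \<subseteq> \<Delta>" and y: "nf_Fn \<Delta> pr_iter [nf \<Delta> y, nf \<Delta> (lift_tm a)] = nf \<Delta> (lift_tm b)"
  have "\<Delta> \<turnstile> Reach (lift_tm a) (CPair Zero (lift_tm v))"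
    using prov_lift[OF ac \<Delta>] by simp
  then have "\<Delta> \<turnstile> Reach (lift_tm b) (CPair Zero (lift_tm v))"
  proof (rule ReachE)
    fix D z
    assume "lift_fm ` \<Delta> \<subseteq> D"
      and z: "nf_Fn D pr_iter [nf D z, nf D (lift_tm (lift_tm a))] = nf D (lift_tm (CPair Zero (lift_tm v)))"
    moreover from y have "\<Delta> \<turnstile> Fn pr_iter [y, lift_tm a] \<^bold>= lift_tm b"
      by (simp add: prov_Eq_iff)
    ultimately have "D \<turnstile> lift_fm (Fn pr_iter [y, lift_tm a] \<^bold>= lift_tm b)"
      by (blast intro: prov_lift)
    then have "nf_Fn D pr_iter [nf D z, nf D (lift_tm (lift_tm b))] = nf_Fn D pr_iter [nf_Fn D pr_add [nf D z, nf D (lift_tm y)], nf D (lift_tm (lift_tm a))]"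
      by (simp add: iter_add prov_Eq_iff)
    also have "\<dots> = nf D (lift_tm (CPair Zero (lift_tm v)))"
      using z by (subst add_commute) (simp add: iter_add)
    finally show "D \<turnstile> lift_fm (Reach (lift_tm b) (CPair Zero (lift_tm v)))"
      by simp (rule ReachI[of _ "nf D z"], subst nf_Fn_normalise, simp)
  qed
  then show "\<Delta> \<turnstile> lift_fm (Reach b (CPair Zero v))" by simp
qed

lemma Reach_halted_eq:
  assumes "\<Gamma> \<turnstile> Reach (CPair Zero u) (CPair Zero v)"
  shows "\<Gamma> \<turnstile> u \<^bold>= v"
proof (rule ReachE[OF assms])
  fix \<Delta> z
  assume "nf_Fn \<Delta> pr_iter [nf \<Delta> z, nf \<Delta> (lift_tm (CPair Zero u))] = nf \<Delta> (lift_tm (CPair Zero v))"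
  then have "nf_Fn \<Delta> pr_snd [nf \<Delta> (lift_tm (CPair Zero u))] = nf_Fn \<Delta> pr_snd [nf \<Delta> (lift_tm (CPair Zero v))]"
    by simp
  then show "\<Delta> \<turnstile> lift_fm (u \<^bold>= v)" by (simp add: prov_Eq_iff)
qed

lemma subst_App [simp]: "subst_fm \<sigma> (App e n y) = App (subst_tm \<sigma> e) (subst_tm \<sigma> n) (subst_tm \<sigma> y)"
  by (simp add: App_def)

lemma lift_App [simp]: "lift_fm (App e n y) = App (lift_tm e) (lift_tm n) (lift_tm y)"
  by (simp add: lift_fm_def)

lemma inst_App [simp]:
  "inst (App e n y) t = App (subst_tm (case_nat t Var) e) (subst_tm (case_nat t Var) n) (subst_tm (case_nat t Var) y)"
  by (simp add: inst_def)

lemma App_iff_Reach: "\<Gamma> \<turnstile> App e n y \<longleftrightarrow> \<Gamma> \<turnstile> Reach (CPair (Push e Zero) n) (CPair Zero y)"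
proof
  assume "\<Gamma> \<turnstile> App e n y"
  then show "\<Gamma> \<turnstile> Reach (CPair (Push e Zero) n) (CPair Zero y)"
    unfolding App_def
  proof (rule ExE_context)
    fix \<Delta> assume "\<Delta> \<turnstile> Fn pr_run [Var 0, lift_tm e, lift_tm n] \<^bold>= CPair Zero (lift_tm y)"
    then show "\<Delta> \<turnstile> lift_fm (Reach (CPair (Push e Zero) n) (CPair Zero y))"
      by simp (rule ReachI[of _ "nf \<Delta> (Var 0)"], subst nf_Fn_normalise, simp add: run_eq_iter prov_Eq_iff)
  qed
next
  assume "\<Gamma> \<turnstile> Reach (CPair (Push e Zero) n) (CPair Zero y)"
  then show "\<Gamma> \<turnstile> App e n y"
  proof (rule ReachE)
    fix \<Delta> z
    assume "nf_Fn \<Delta> pr_iter [nf \<Delta> z, nf \<Delta> (lift_tm (CPair (Push e Zero) n))] = nf \<Delta> (lift_tm (CPair Zero y))"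
    then show "\<Delta> \<turnstile> lift_fm (App e n y)"
      unfolding lift_App unfolding App_def by (intro ExI[of _ _ z]) (simp add: run_eq_iter prov_Eq_iff)
  qed
qed

text \<open>Unlike \<open>\<Gamma> \<turnstile> Reach a b\<close>, this has the target state as last argument, so that it can be chained.\<close>

definition reaches :: "fm set \<Rightarrow> tm \<Rightarrow> tm \<Rightarrow> bool" where
  "reaches \<Gamma> a b \<longleftrightarrow> \<Gamma> \<turnstile> Reach a b"

lemma reaches_trans [trans]: "reaches \<Gamma> a b \<Longrightarrow> reaches \<Gamma> b c \<Longrightarrow> reaches \<Gamma> a c"
  unfolding reaches_def by (rule Reach_trans)

lemma reaches_eq: "nf \<Gamma> a = nf \<Gamma> b \<Longrightarrow> reaches \<Gamma> a b"
  unfolding reaches_def by (rule Reach_eq)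

lemma reaches_step: "nf \<Gamma> (Fn pr_step [a]) = nf \<Gamma> b \<Longrightarrow> reaches \<Gamma> a b"
  unfolding reaches_def by (rule Reach_step)

text \<open>The arbitrary stack below the index is what allows a computation to be reused as a
  subroutine of a larger one.\<close>

definition computes :: "fm set \<Rightarrow> tm \<Rightarrow> tm \<Rightarrow> tm \<Rightarrow> bool" where
  "computes \<Gamma> e n y \<longleftrightarrow> (\<forall>s. reaches \<Gamma> (CPair (Push e s) n) (CPair s y))"

lemma computes_eq:
  assumes "computes \<Gamma> e n y" "nf \<Gamma> e' = nf \<Gamma> e" "nf \<Gamma> n' = nf \<Gamma> n" "nf \<Gamma> y = nf \<Gamma> y'"
  shows "computes \<Gamma> e' n' y'"
  unfolding computes_def
proof
  fix s
  have "reaches \<Gamma> (CPair (Push e' s) n') (CPair (Push e s) n)" by (rule reaches_eq) (simp add: assms)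
  also have "reaches \<Gamma> \<dots> (CPair s y)" using assms(1) by (simp add: computes_def)
  also have "reaches \<Gamma> \<dots> (CPair s y')" by (rule reaches_eq) (simp add: assms)
  finally show "reaches \<Gamma> (CPair (Push e' s) n') (CPair s y')" .
qed

lemma computesD: "computes \<Gamma> e n y \<Longrightarrow> reaches \<Gamma> (CPair (Push e s) n) (CPair s y)"
  by (simp add: computes_def)

lemma computes_App: "computes \<Gamma> e n y \<Longrightarrow> \<Gamma> \<turnstile> App e n y"
  by (simp add: App_iff_Reach computesD flip: reaches_def)

lemmas exec_simps = prov_Eq_iff step_push pr_exec_def Let_def num_numeral num.simps

section \<open>Behaviour of the individual instructions\<close>

lemma computes_const: "computes \<Gamma> (CPair (num 0) c) v c"
  unfolding computes_def by (intro allI reaches_step) (simp add: exec_simps)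

lemma computes_succ: "computes \<Gamma> (CPair (num (Suc 0)) d) v (Succ v)"
  unfolding computes_def by (intro allI reaches_step) (simp add: exec_simps)

lemma computes_fst: "computes \<Gamma> (CPair (num 2) d) (CPair u v) u"
  unfolding computes_def by (intro allI reaches_step) (simp add: exec_simps)

lemma computes_snd: "computes \<Gamma> (CPair (num 3) d) (CPair u v) v"
  unfolding computes_def by (intro allI reaches_step) (simp add: exec_simps)

lemma computes_pair_left: "computes \<Gamma> (CPair (num 8) x) v (CPair x v)"
  unfolding computes_def by (intro allI reaches_step) (simp add: exec_simps)

abbreviation compose_index :: "tm \<Rightarrow> tm \<Rightarrow> tm" where
  "compose_index a b \<equiv> CPair (num 4) (CPair a b)"

lemma reaches_compose: "reaches \<Gamma> (CPair (Push (compose_index a b) s) v) (CPair (Push b (Push a s)) v)"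
  by (rule reaches_step) (simp add: exec_simps)

lemma computes_compose:
  assumes "computes \<Gamma> b v u" "computes \<Gamma> a u y"
  shows "computes \<Gamma> (compose_index a b) v y"
  unfolding computes_def by (blast intro: reaches_compose reaches_trans computesD[OF assms(1)] computesD[OF assms(2)])

abbreviation pair_index :: "tm \<Rightarrow> tm \<Rightarrow> tm" where
  "pair_index a b \<equiv> CPair (num 5) (CPair a b)"

lemma computes_pair:
  assumes "computes \<Gamma> a v x" "computes \<Gamma> b v y"
  shows "computes \<Gamma> (pair_index a b) v (CPair x y)"
  unfolding computes_def
proof
  fix s
  have "reaches \<Gamma> (CPair (Push (pair_index a b) s) v) (CPair (Push a (Push (CPair (num 9) (CPair b v)) s)) v)"
    by (rule reaches_step) (simp add: exec_simps)
  also have "reaches \<Gamma> \<dots> (CPair (Push (CPair (num 9) (CPair b v)) s) x)"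
    by (rule computesD[OF assms(1)])
  also have "reaches \<Gamma> \<dots> (CPair (Push b (Push (CPair (num 8) x) s)) v)"
    by (rule reaches_step) (simp add: exec_simps)
  also have "reaches \<Gamma> \<dots> (CPair (Push (CPair (num 8) x) s) y)"
    by (rule computesD[OF assms(2)])
  also have "reaches \<Gamma> \<dots> (CPair s (CPair x y))"
    by (rule computesD[OF computes_pair_left])
  finally show "reaches \<Gamma> (CPair (Push (pair_index a b) s) v) (CPair s (CPair x y))" .
qed

abbreviation rec_index :: "tm \<Rightarrow> tm \<Rightarrow> tm" where
  "rec_index a b \<equiv> CPair (num 6) (CPair a b)"

lemma reaches_rec_Zero:
  "reaches \<Gamma> (CPair (Push (rec_index a b) s) (CPair Zero p)) (CPair (Push a s) p)"
  by (rule reaches_step) (simp add: exec_simps)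

lemma reaches_rec_Succ:
  "reaches \<Gamma> (CPair (Push (rec_index a b) s) (CPair (Succ k) p))
    (CPair (Push (rec_index a b) (Push (CPair (num 8) (CPair k p)) (Push b s))) (CPair k p))"
  by (rule reaches_step) (simp add: exec_simps)

section \<open>Indices of primitive recursive functions\<close>

text \<open>An argument list is coded by iterated pairing ending in \<open>0 = \<langle>0, 0\<rangle>\<close>, in accordance with its continuation by zeros.\<close>

primrec tuple :: "tm list \<Rightarrow> tm" where
  "tuple [] = Zero"
| "tuple (t # ts) = CPair t (tuple ts)"

lemma subst_tuple [simp]: "subst_tm \<sigma> (tuple ts) = tuple (map (subst_tm \<sigma>) ts)"
  by (induction ts) simp_all

primrec proj_index :: "nat \<Rightarrow> tm" where
  "proj_index 0 = CPair (num 2) Zero"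
| "proj_index (Suc i) = compose_index (proj_index i) (CPair (num 3) Zero)"

primrec tuple_index :: "tm list \<Rightarrow> tm" where
  "tuple_index [] = CPair (num 0) Zero"
| "tuple_index (e # es) = pair_index e (tuple_index es)"

text \<open>In the recursion clause the machine supplies \<langle>\<langle>k, p\<rangle>,
  r\<rangle>, whereas \<open>PRec\<close> passes the recursive value r first; the pair of
  projections swaps the two components.\<close>

primrec index :: "prfun \<Rightarrow> tm" where
  "index PZero = CPair (num 0) Zero"
| "index PSucc = compose_index (CPair (num (Suc 0)) Zero) (CPair (num 2) Zero)"
| "index (PProj i) = proj_index i"
| "index (PComp f gs) = compose_index (index f) (tuple_index (map index gs))"
| "index (PRec f g) = rec_index (index f)
    (compose_index (index g) (pair_index (CPair (num 3) Zero) (CPair (num 2) Zero)))"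

lemma subst_proj_index [simp]: "subst_tm \<sigma> (proj_index i) = proj_index i"
  by (induction i) simp_all

lemma subst_tuple_index [simp]: "subst_tm \<sigma> (tuple_index es) = tuple_index (map (subst_tm \<sigma>) es)"
  by (induction es) simp_all

lemma subst_index [simp]: "subst_tm \<sigma> (index f) = index f"
  by (induction f) (simp_all cong: map_cong)

lemma lift_index [simp]: "lift_tm (index f) = index f"
  using subst_index unfolding lift_tm_def .

lemma computes_proj: "computes \<Gamma> (proj_index i) (tuple ts) (arg i ts)"
proof (induction i arbitrary: ts)
  case 0
  show ?case
  proof (cases ts)
    case Nil
    \<comment> \<open>Beyond the end of the list the code is 0 = \<langle>0, 0\<rangle>, both of
      whose projections are 0 again.\<close>
    show ?thesis by (rule computes_eq[OF computes_fst[of \<Gamma> Zero Zero Zero]]) (simp_all add: Nil)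
  qed (simp add: computes_fst)
next
  case (Suc i)
  show ?case
  proof (cases ts)
    case Nil
    have "computes \<Gamma> (CPair (num 3) Zero) Zero (tuple [])"
      by (rule computes_eq[OF computes_snd[of \<Gamma> Zero Zero Zero]]) simp_all
    with Suc[of "[]"] Nil show ?thesis by (auto intro: computes_compose)
  next
    case (Cons t us)
    with Suc[of us] show ?thesis by (auto intro: computes_compose computes_snd)
  qed
qed

lemma computes_tuple:
  assumes "list_all2 (\<lambda>e y. computes \<Gamma> e v y) es ys"
  shows "computes \<Gamma> (tuple_index es) v (tuple ys)"
  using assms by (induction rule: list_all2_induct) (simp_all add: computes_pair computes_const)

text \<open>The recursion argument is any object term, so the recursion is unwound by an induction
  inside the calculus. Its formula quantifies over the stack, since the recursive call runs on a
  longer one. The hypotheses on f and g range over all contexts because the induction step lives in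
  a new context.\<close>

lemma computes_rec:
  assumes f: "\<And>\<Gamma> ts. computes \<Gamma> (index f) (tuple ts) (Fn f ts)"
    and g: "\<And>\<Gamma> ts. computes \<Gamma> (index g) (tuple ts) (Fn g ts)"
  shows "computes \<Gamma> (index (PRec f g)) (tuple (t # ts)) (Fn (PRec f g) (t # ts))"
proof -
  let ?b = "compose_index (index g) (pair_index (CPair (num 3) Zero) (CPair (num 2) Zero))"
  let ?R = "\<lambda>k ts s. Reach (CPair (Push (index (PRec f g)) s) (tuple (k # ts))) (CPair s (Fn (PRec f g) (k # ts)))"
  \<comment> \<open>The parameters are lifted twice, past the stack (index 0) and the induction
    variable (index 1).\<close>
  let ?ts = "map lift_tm (map lift_tm ts)"
  have *: "reaches \<Gamma> (CPair (Push (index (PRec f g)) s) (tuple (Zero # ts))) (CPair s (Fn (PRec f g) (Zero # ts)))" for \<Gamma> ts s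
  proof -
    have "reaches \<Gamma> (CPair (Push (index (PRec f g)) s) (tuple (Zero # ts))) (CPair (Push (index f) s) (tuple ts))"
      using reaches_rec_Zero by simp
    also have "reaches \<Gamma> \<dots> (CPair s (Fn f ts))" by (rule computesD[OF f])
    also have "reaches \<Gamma> \<dots> (CPair s (Fn (PRec f g) (Zero # ts)))"
      by (rule reaches_eq) (simp add: nf_Fn_PRec_Zero)
    finally show ?thesis .
  qed
  have "\<Gamma> \<turnstile> inst (Forall (?R (Var 1) ?ts (Var 0))) t"
  proof (rule prov_induct)
    show "\<Gamma> \<turnstile> inst (Forall (?R (Var 1) ?ts (Var 0))) Zero"
      using *[unfolded reaches_def] by (simp add: inst_def comp_def AllI)
  next
    fix \<Delta> assume IH: "\<Delta> \<turnstile> Forall (?R (Var 1) ?ts (Var 0))"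
    have "\<Delta>' \<turnstile> ?R (Succ (Var 1)) ?ts (Var 0)" if "lift_fm ` \<Delta> \<subseteq> \<Delta>'" for \<Delta>'
    proof -
      let ?k = "Var 1" and ?s = "Var 0"
      have "\<Delta>' \<turnstile> Forall (?R (Var 2) (map lift_tm ?ts) (Var 0))"
        using prov_lift[OF IH that] by (simp add: lift_fm_def numeral_2_eq_2 comp_def)
      from AllE[OF this] have IH': "reaches \<Delta>' (CPair (Push (index (PRec f g)) s) (tuple (?k # ?ts))) (CPair s (Fn (PRec f g) (?k # ?ts)))" for s
        by (simp add: reaches_def comp_def)
      let ?r = "Fn (PRec f g) (?k # ?ts)" and ?v = "tuple (?k # ?ts)"
      have "reaches \<Delta>' (CPair (Push (index (PRec f g)) ?s) (tuple (Succ ?k # ?ts)))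
          (CPair (Push (index (PRec f g)) (Push (CPair (num 8) ?v) (Push ?b ?s))) ?v)"
        unfolding index.simps tuple.simps by (rule reaches_rec_Succ)
      also have "reaches \<Delta>' \<dots> (CPair (Push (CPair (num 8) ?v) (Push ?b ?s)) ?r)"
        by (rule IH')
      also have "reaches \<Delta>' \<dots> (CPair (Push ?b ?s) (CPair ?v ?r))"
        by (rule computesD[OF computes_pair_left])
      also have "reaches \<Delta>' \<dots> (CPair ?s (Fn g (?r # ?k # ?ts)))"
        using g[of \<Delta>' "?r # ?k # ?ts"] unfolding tuple.simps
        by (rule computesD[OF computes_compose[OF computes_pair[OF computes_snd computes_fst]]])
      also have "reaches \<Delta>' \<dots> (CPair ?s (Fn (PRec f g) (Succ ?k # ?ts)))"
        by (rule reaches_eq) (simp add: nf_Fn_PRec_Succ)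
      finally show ?thesis by (simp only: reaches_def)
    qed
    then show "\<Delta> \<turnstile> inst_Succ (Forall (?R (Var 1) ?ts (Var 0)))"
      by (simp add: inst_Succ_def AllI_context comp_def)
  qed
  then have "\<Gamma> \<turnstile> Forall (?R (lift_tm t) (map lift_tm ts) (Var 0))"
    by (simp add: inst_def comp_def)
  from AllE[OF this] show ?thesis by (simp add: computes_def reaches_def comp_def)
qed

text \<open>This makes primitive recursive operations on indices available to the machine itself, as
  the recursion theorem requires.\<close>

lemma computes_index: "computes \<Gamma> (index f) (tuple ts) (Fn f ts)"
proof (induction f arbitrary: \<Gamma> ts)
  case PZero
  show ?case by (rule computes_const[THEN computes_eq]) (simp_all only: index.simps, simp)
next
  case PSucc
  have "computes \<Gamma> (index PSucc) (tuple ts) (Succ (arg 0 ts))"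
    using computes_proj[of \<Gamma> 0 ts] by (auto intro: computes_compose computes_succ)
  then show ?case by (rule computes_eq) (simp_all, cases ts, simp_all)
next
  case (PProj i)
  show ?case using computes_proj[of \<Gamma> i ts]
    by (rule computes_eq) (simp_all add: arg_def)
next
  case (PComp f gs)
  have "computes \<Gamma> (tuple_index (map index gs)) (tuple ts) (tuple (map (\<lambda>g. Fn g ts) gs))"
    by (rule computes_tuple) (simp add: list_all2_conv_all_nth PComp.IH(2))
  from computes_compose[OF this PComp.IH(1)] show ?case
    by (rule computes_eq) (simp_all add: comp_def)
next
  case (PRec f g)
  note * = computes_rec[of f g, OF PRec]
  show ?case
  proof (cases ts)
    case Nil
    \<comment> \<open>The empty list has the same code as the list consisting of
      \<open>Zero\<close>, and on both the recursion yields the value of f at the empty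
      list.\<close>
    show ?thesis using *[of \<Gamma> Zero "[]"] by (rule computes_eq) (simp_all add: Nil nf_Fn_PRec_Nil nf_Fn_PRec_Zero)
  qed (simp add: *[simplified])
qed

section \<open>Conditions\<close>

lemma subst_Defined [simp]: "subst_fm \<sigma> (Defined e n) = Defined (subst_tm \<sigma> e) (subst_tm \<sigma> n)"
  by (simp add: Defined_def)

lemma lift_Defined [simp]: "lift_fm (Defined e n) = Defined (lift_tm e) (lift_tm n)"
  by (simp add: lift_fm_def)

lemma inst_Defined [simp]:
  "inst (Defined e n) t = Defined (subst_tm (case_nat t Var) e) (subst_tm (case_nat t Var) n)"
  by (simp add: inst_def)

lemma subst_At [simp]:
  "subst_fm \<sigma> (At Mean e n) = At Mean (subst_tm \<sigma> e) (subst_tm \<sigma> n)"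
  "subst_fm \<sigma> (At Tru e n) = At Tru (subst_tm \<sigma> e) (subst_tm \<sigma> n)"
  by (simp_all add: At_def)

lemma lift_At [simp]:
  "lift_fm (At Mean e n) = At Mean (lift_tm e) (lift_tm n)"
  "lift_fm (At Tru e n) = At Tru (lift_tm e) (lift_tm n)"
  by (simp_all add: lift_fm_def)

lemma inst_At [simp]:
  "inst (At Mean e n) t = At Mean (subst_tm (case_nat t Var) e) (subst_tm (case_nat t Var) n)"
  "inst (At Tru e n) t = At Tru (subst_tm (case_nat t Var) e) (subst_tm (case_nat t Var) n)"
  by (simp_all add: inst_def)

lemma Mean_eq: "\<Gamma> \<turnstile> s \<^bold>= t \<Longrightarrow> \<Gamma> \<turnstile> Mean s \<Longrightarrow> \<Gamma> \<turnstile> Mean t"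
  using Eq_subst[of \<Gamma> s t "Mean (Var 0)"] by simp

lemma Tru_eq: "\<Gamma> \<turnstile> s \<^bold>= t \<Longrightarrow> \<Gamma> \<turnstile> Tru s \<Longrightarrow> \<Gamma> \<turnstile> Tru t"
  using Eq_subst[of \<Gamma> s t "Tru (Var 0)"] by simp

lemma App_unique: "\<Gamma> \<turnstile> App e n y \<Longrightarrow> \<Gamma> \<turnstile> App e n z \<Longrightarrow> \<Gamma> \<turnstile> y \<^bold>= z"
  unfolding App_iff_Reach by (blast intro: Reach_halted_unique Reach_halted_eq)

lemma DefinedI: "\<Gamma> \<turnstile> App e n y \<Longrightarrow> \<Gamma> \<turnstile> Defined e n"
  unfolding Defined_def by (rule ExI[of _ _ y]) simp

text \<open>Since values are unique, a known value y decides \<open>At\<close>. \<open>P\<close> is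
  a function of the metalanguage; membership in the two-element set guarantees that it commutes with
  lifting and respects provable equality.\<close>

lemma At_iff:
  assumes "P \<in> {Mean, Tru}" and y: "\<Gamma> \<turnstile> App e n y"
  shows "\<Gamma> \<turnstile> At P e n \<longleftrightarrow> \<Gamma> \<turnstile> P y"
proof
  assume "\<Gamma> \<turnstile> At P e n"
  then show "\<Gamma> \<turnstile> P y"
    unfolding At_def
  proof (rule ExE_context)
    fix \<Delta>
    assume \<Delta>: "lift_fm ` \<Gamma> \<subseteq> \<Delta>" and *: "\<Delta> \<turnstile> App (lift_tm e) (lift_tm n) (Var 0) \<^bold>\<and> P (Var 0)"
    have "\<Delta> \<turnstile> App (lift_tm e) (lift_tm n) (lift_tm y)"
      using prov_lift[OF y \<Delta>] by simp
    with * have "\<Delta> \<turnstile> Var 0 \<^bold>= lift_tm y" by (blast intro: App_unique ConjE1)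
    moreover from * have "\<Delta> \<turnstile> P (Var 0)" by (rule ConjE2)
    ultimately show "\<Delta> \<turnstile> lift_fm (P y)"
      using assms(1) by (auto intro: Mean_eq Tru_eq)
  qed
next
  assume "\<Gamma> \<turnstile> P y"
  with assms show "\<Gamma> \<turnstile> At P e n"
    unfolding At_def by (intro ExI[of _ _ y]) (auto intro: ConjI)
qed

text \<open>For applications whose value is not given by a term, such as those of \<mu>: the unknown
  value is a fresh variable in \<Delta>.\<close>

lemma At_cong:
  assumes "P \<in> {Mean, Tru}"
    and "\<And>\<Delta> y. lift_fm ` \<Gamma> \<subseteq> \<Delta> \<Longrightarrow> \<Delta> \<turnstile> App (lift_tm e) (lift_tm n) y \<Longrightarrow> \<Delta> \<turnstile> App (lift_tm e') (lift_tm n') y"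
    and "\<Gamma> \<turnstile> At P e n"
  shows "\<Gamma> \<turnstile> At P e' n'"
  using assms(3) unfolding At_def
proof (rule ExE_context)
  fix \<Delta>
  assume \<Delta>: "lift_fm ` \<Gamma> \<subseteq> \<Delta>" and "\<Delta> \<turnstile> App (lift_tm e) (lift_tm n) (Var 0) \<^bold>\<and> P (Var 0)"
  then have "\<Delta> \<turnstile> App (lift_tm e') (lift_tm n') (Var 0)" "\<Delta> \<turnstile> P (Var 0)"
    using assms(2) by (blast intro: ConjE1 ConjE2)+
  then have "\<Delta> \<turnstile> At P (lift_tm e') (lift_tm n')"
    using assms(1) by (simp add: At_iff)
  then show "\<Delta> \<turnstile> lift_fm (Exists (App (lift_tm e') (lift_tm n') (Var 0) \<^bold>\<and> P (Var 0)))"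
    using assms(1) unfolding At_def[symmetric] by auto
qed

lemma At_Defined:
  assumes "P \<in> {Mean, Tru}" and "\<Gamma> \<turnstile> At P e n"
  shows "\<Gamma> \<turnstile> Defined e n"
  using assms(2) unfolding At_def
proof (rule ExE_context)
  fix \<Delta> assume "\<Delta> \<turnstile> App (lift_tm e) (lift_tm n) (Var 0) \<^bold>\<and> P (Var 0)"
  then show "\<Delta> \<turnstile> lift_fm (Defined e n)" by (auto intro: DefinedI ConjE1)
qed

lemma subst_X1_X2 [simp]: "subst_fm \<sigma> (X1 Xi) = X1 Xi" "subst_fm \<sigma> (X2 Xi) = X2 Xi"
  by (simp_all add: X1_def X2_def numeral_2_eq_2)

lemma lift_X1_X2 [simp]: "lift_fm (X1 Xi) = X1 Xi" "lift_fm (X2 Xi) = X2 Xi"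
  by (simp_all add: lift_fm_def)

section \<open>Introduction and elimination rules for conditions built by \<Xi>\<close>

lemma X1_inst:
  assumes "\<Gamma> \<turnstile> X1 Xi" and "\<Gamma> \<turnstile> Mean (Fn Xi [f, g])"
  shows "\<Gamma> \<turnstile> Tru (Fn Xi [f, g]) \<^bold>\<longleftrightarrow>
    Forall (Defined (lift_tm f) (Var 0) \<^bold>\<and> At Tru (lift_tm f) (Var 0)
      \<^bold>\<longrightarrow> Defined (lift_tm g) (Var 0) \<^bold>\<and> At Tru (lift_tm g) (Var 0))"
  using AllE[OF AllE[OF assms(1)[unfolded X1_def], of f, unfolded inst_def subst_fm.simps], of g] assms(2)
  by (simp add: inst_def) (rule ImplE)

lemma Tru_XiI:
  assumes "\<Gamma> \<turnstile> X1 Xi" "\<Gamma> \<turnstile> Mean (Fn Xi [f, g])"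
    and "\<And>\<Delta> n. lift_fm ` \<Gamma> \<subseteq> \<Delta> \<Longrightarrow> \<Delta> \<turnstile> At Tru (lift_tm f) n \<Longrightarrow> \<Delta> \<turnstile> At Tru (lift_tm g) n"
  shows "\<Gamma> \<turnstile> Tru (Fn Xi [f, g])"
proof (rule ImplE[OF ConjE2[OF X1_inst[OF assms(1,2)]]], rule AllI_context, rule ImplI_context)
  fix \<Delta> D
  assume "lift_fm ` \<Gamma> \<subseteq> \<Delta>" "\<Delta> \<subseteq> D" "D \<turnstile> Defined (lift_tm f) (Var 0) \<^bold>\<and> At Tru (lift_tm f) (Var 0)"
  then have "D \<turnstile> At Tru (lift_tm g) (Var 0)"
    by (intro assms(3)) (auto intro: ConjE2)
  then show "D \<turnstile> Defined (lift_tm g) (Var 0) \<^bold>\<and> At Tru (lift_tm g) (Var 0)"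
    by (blast intro: ConjI At_Defined)
qed

lemma Tru_XiD:
  assumes "\<Gamma> \<turnstile> X1 Xi" "\<Gamma> \<turnstile> Mean (Fn Xi [f, g])" "\<Gamma> \<turnstile> Tru (Fn Xi [f, g])" "\<Gamma> \<turnstile> At Tru f n"
  shows "\<Gamma> \<turnstile> At Tru g n"
proof -
  have "\<Gamma> \<turnstile> Defined f n \<^bold>\<and> At Tru f n \<^bold>\<longrightarrow> Defined g n \<^bold>\<and> At Tru g n"
    using AllE[OF ImplE[OF ConjE1[OF X1_inst[OF assms(1,2)]] assms(3)], of n] by simp
  moreover have "\<Gamma> \<turnstile> Defined f n \<^bold>\<and> At Tru f n"
    using assms(4) by (blast intro: ConjI At_Defined)
  ultimately show ?thesis by (blast intro: ImplE ConjE2)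
qed

text \<open>X2 in the form for a total f with meaningful values, the only kind of antecedent used
  below.\<close>

lemma Mean_XiI:
  assumes "\<Gamma> \<turnstile> X2 Xi"
    and f: "\<And>\<Delta> n. lift_fm ` \<Gamma> \<subseteq> \<Delta> \<Longrightarrow> \<Delta> \<turnstile> At Mean (lift_tm f) n"
    and g: "\<And>\<Delta> n. lift_fm ` \<Gamma> \<subseteq> \<Delta> \<Longrightarrow> \<Delta> \<turnstile> At Tru (lift_tm f) n \<Longrightarrow> \<Delta> \<turnstile> At Mean (lift_tm g) n"
  shows "\<Gamma> \<turnstile> Mean (Fn Xi [f, g])"
proof -
  have "\<Gamma> \<turnstile> Forall (Defined (lift_tm f) (Var 0) \<^bold>\<longrightarrow> At Mean (lift_tm f) (Var 0))"
    by (intro AllI_context ImplI_context f) blast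
  moreover have "\<Gamma> \<turnstile> Forall (Defined (lift_tm f) (Var 0) \<^bold>\<and> Defined (lift_tm g) (Var 0) \<^bold>\<and> At Tru (lift_tm f) (Var 0)
      \<^bold>\<longrightarrow> At Mean (lift_tm g) (Var 0))"
    by (intro AllI_context ImplI_context g) (blast, blast intro: ConjE2)
  ultimately show ?thesis
    using AllE[OF AllE[OF assms(1)[unfolded X2_def], of f, unfolded inst_def subst_fm.simps], of g]
    by (simp add: inst_def) (blast intro: ImplE ConjI)
qed

section \<open>The liar condition\<close>

abbreviation const_index :: "tm \<Rightarrow> tm" where
  "const_index y \<equiv> CPair (num 0) y"

abbreviation curry_index :: "tm \<Rightarrow> tm \<Rightarrow> tm" where
  "curry_index e n \<equiv> compose_index e (CPair (num 8) n)"

lemma App_const: "\<Gamma> \<turnstile> App (const_index y) n y"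
  by (rule computes_App[OF computes_const])

text \<open>The run of e on \<langle>n, m\<rangle> is a tail of the run on the left. One direction
  composes runs, the other uses determinism. This covers every e, as it must for \<mu>, which is
  merely a variable.\<close>

lemma App_curry: "\<Gamma> \<turnstile> App (curry_index e n) m y \<longleftrightarrow> \<Gamma> \<turnstile> App e (CPair n m) y"
proof -
  have "reaches \<Gamma> (CPair (Push (curry_index e n) Zero) m) (CPair (Push (CPair (num 8) n) (Push e Zero)) m)"
    by (rule reaches_compose)
  also have "reaches \<Gamma> \<dots> (CPair (Push e Zero) (CPair n m))"
    by (rule computesD[OF computes_pair_left])
  finally show ?thesis
    unfolding App_iff_Reach reaches_def by (blast intro: Reach_trans Reach_halted_unique)
qed

lemma At_curry:
  assumes "P \<in> {Mean, Tru}"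
  shows "\<Gamma> \<turnstile> At P (curry_index e n) m \<longleftrightarrow> \<Gamma> \<turnstile> At P e (CPair n m)"
  by (intro iffI; erule At_cong[OF assms, rotated]) (simp_all add: App_curry)

text \<open>
  \<open>guarded Xi \<mu> n\<close> expresses that \<open>n\<close> is true if it is meaningful, provided that \<open>\<mu>\<close> enumerates meaningfulness as in
  the theorem.
\<close>

definition guarded :: "prfun \<Rightarrow> tm \<Rightarrow> tm \<Rightarrow> tm" where
  "guarded Xi \<mu> n = Fn Xi [curry_index \<mu> n, const_index n]"

text \<open>The index of \<open>v \<mapsto> x \<langle>x, 0\<rangle>\<close>.\<close>

definition self_index :: "tm \<Rightarrow> tm" where
  "self_index x = compose_index x (const_index (CPair x Zero))"

text \<open>\<open>(\<mu>, b, x) \<mapsto> guarded Xi \<mu> (Xi (self_index x, const_index b))\<close>\<close>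

definition pr_guarded :: "prfun \<Rightarrow> prfun" where
  "pr_guarded Xi =
    (let x = PProj 2;
         f = p_pair (p_num 4) (p_pair x (p_pair (p_num 0) (p_pair x PZero)));
         n = PComp Xi [f, p_pair (p_num 0) (PProj 1)]
     in PComp Xi [p_pair (p_num 4) (p_pair (PProj 0) (p_pair (p_num 8) n)), p_pair (p_num 0) n])"

text \<open>
  The second recursion theorem: with \<open>d\<close> the argument of \<open>self_index\<close>, this function maps everything to \<open>d \<langle>d, 0\<rangle>\<close>,
  which is the value of \<open>pr_guarded Xi\<close> at \<open>(\<mu>, b, d)\<close> and thus mentions \<open>self_index d\<close>, its own index.
\<close>

definition liar_fun :: "prfun \<Rightarrow> tm \<Rightarrow> tm \<Rightarrow> tm" where
  "liar_fun Xi \<mu> b = self_index (curry_index (curry_index (index (pr_guarded Xi)) \<mu>) b)"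

text \<open>The self-referential n of the overview, with b in the role of \<bottom>: once b is not
  true, its truth says that \<open>guarded Xi \<mu> (liar Xi \<mu> b)\<close> is not true.\<close>

definition liar :: "prfun \<Rightarrow> tm \<Rightarrow> tm \<Rightarrow> tm" where
  "liar Xi \<mu> b = Fn Xi [liar_fun Xi \<mu> b, const_index b]"

lemma lift_liar_fun [simp]: "lift_tm (liar_fun Xi \<mu> b) = liar_fun Xi (lift_tm \<mu>) (lift_tm b)"
  by (simp add: liar_fun_def self_index_def)

lemma App_liar_fun: "\<Gamma> \<turnstile> App (liar_fun Xi \<mu> b) m (guarded Xi \<mu> (liar Xi \<mu> b))"
proof -
  define d where "d = curry_index (curry_index (index (pr_guarded Xi)) \<mu>) b"
  have liar_fun: "liar_fun Xi \<mu> b = self_index d" by (simp only: liar_fun_def d_def)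
  \<comment> \<open>The code of a three-element list ends in \<open>Zero\<close>. Currying \<mu> and
    b away leaves \<langle>d, 0\<rangle>, which is why \<open>self_index\<close> applies x to
    \<langle>x, 0\<rangle> instead of x.\<close>
  have "computes \<Gamma> (index (pr_guarded Xi)) (CPair \<mu> (CPair b (CPair d Zero))) (Fn (pr_guarded Xi) [\<mu>, b, d])"
    using computes_index[of \<Gamma> "pr_guarded Xi" "[\<mu>, b, d]"] by simp
  then have "computes \<Gamma> d (CPair d Zero) (Fn (pr_guarded Xi) [\<mu>, b, d])"
    by (subst d_def) (intro computes_compose[OF computes_pair_left])
  then have "computes \<Gamma> (liar_fun Xi \<mu> b) m (Fn (pr_guarded Xi) [\<mu>, b, d])"
    unfolding liar_fun self_index_def by (rule computes_compose[OF computes_const])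
  \<comment> \<open>Unfolding \<open>pr_guarded\<close> at (\<mu>, b, d) rebuilds term by term the
    indices inside \<open>guarded\<close> and \<open>liar\<close>, including
    \<open>self_index d\<close>.\<close>
  then have "computes \<Gamma> (liar_fun Xi \<mu> b) m (guarded Xi \<mu> (liar Xi \<mu> b))"
    by (rule computes_eq)
      (simp_all add: pr_guarded_def guarded_def liar_def liar_fun self_index_def Let_def num.simps)
  then show ?thesis by (rule computes_App)
qed

section \<open>Refuting an enumerator of meaningfulness\<close>

definition meaning_enumerator :: "tm \<Rightarrow> fm" where
  "meaning_enumerator \<mu> =
    (Forall (Forall (Defined (lift_tm (lift_tm \<mu>)) (CPair (Var 1) (Var 0))
        \<^bold>\<and> At Mean (lift_tm (lift_tm \<mu>)) (CPair (Var 1) (Var 0))))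
     \<^bold>\<and> Forall (Mean (Var 0) \<^bold>\<longleftrightarrow> Exists (At Tru (lift_tm (lift_tm \<mu>)) (CPair (Var 1) (Var 0)))))"

lemma lift_meaning_enumerator [simp]: "lift_fm (meaning_enumerator \<mu>) = meaning_enumerator (lift_tm \<mu>)"
  by (simp add: meaning_enumerator_def lift_fm_def)

lemma meaning_enumerator_Mean:
  assumes "\<Gamma> \<turnstile> meaning_enumerator \<mu>"
  shows "\<Gamma> \<turnstile> At Mean \<mu> (CPair n m)"
proof -
  have "\<Gamma> \<turnstile> Forall (Forall (Defined (lift_tm (lift_tm \<mu>)) (CPair (Var 1) (Var 0))
        \<^bold>\<and> At Mean (lift_tm (lift_tm \<mu>)) (CPair (Var 1) (Var 0))))"
    using assms unfolding meaning_enumerator_def by (rule ConjE1)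
  from AllE[OF AllE[OF this, of n, unfolded inst_def subst_fm.simps], of m] show ?thesis
    by (simp add: inst_def) (rule ConjE2)
qed

lemma meaning_enumerator_iff:
  assumes "\<Gamma> \<turnstile> meaning_enumerator \<mu>"
  shows "\<Gamma> \<turnstile> Mean n \<^bold>\<longleftrightarrow> Exists (At Tru (lift_tm \<mu>) (CPair (lift_tm n) (Var 0)))"
  using AllE[OF ConjE2[OF assms[unfolded meaning_enumerator_def]], of n] by (simp add: inst_def)

text \<open>The standing hypotheses in a form that survives passage under a quantifier: X1 and X2
  are closed, and only \<mu> and b have to be lifted.\<close>

definition paradox_context :: "prfun \<Rightarrow> tm \<Rightarrow> tm \<Rightarrow> fm set \<Rightarrow> bool" where
  "paradox_context Xi \<mu> b \<Gamma> \<longleftrightarrow>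
    (\<Gamma> \<turnstile> X1 Xi) \<and> (\<Gamma> \<turnstile> X2 Xi) \<and> (\<Gamma> \<turnstile> Mean b) \<and> (\<Gamma> \<turnstile> \<^bold>\<not> Tru b) \<and> (\<Gamma> \<turnstile> meaning_enumerator \<mu>)"

lemma paradox_context_lift:
  "paradox_context Xi \<mu> b \<Gamma> \<Longrightarrow> lift_fm ` \<Gamma> \<subseteq> \<Delta> \<Longrightarrow> paradox_context Xi (lift_tm \<mu>) (lift_tm b) \<Delta>"
  unfolding paradox_context_def
  using prov_lift[of \<Gamma> "X1 Xi" \<Delta>] prov_lift[of \<Gamma> "X2 Xi" \<Delta>] prov_lift[of \<Gamma> "Mean b" \<Delta>]
    prov_lift[of \<Gamma> "\<^bold>\<not> Tru b" \<Delta>] prov_lift[of \<Gamma> "meaning_enumerator \<mu>" \<Delta>] by simp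

lemma Mean_guarded:
  assumes "paradox_context Xi \<mu> b \<Gamma>"
  shows "\<Gamma> \<turnstile> Mean (guarded Xi \<mu> n)"
  unfolding guarded_def
proof (rule Mean_XiI)
  show "\<Gamma> \<turnstile> X2 Xi" using assms by (simp add: paradox_context_def)
next
  fix \<Delta> m assume "lift_fm ` \<Gamma> \<subseteq> \<Delta>"
  then have \<Delta>: "paradox_context Xi (lift_tm \<mu>) (lift_tm b) \<Delta>" using assms by (rule paradox_context_lift[rotated])
  then show "\<Delta> \<turnstile> At Mean (lift_tm (curry_index \<mu> n)) m"
    by (simp add: At_curry paradox_context_def meaning_enumerator_Mean)
  assume "\<Delta> \<turnstile> At Tru (lift_tm (curry_index \<mu> n)) m"
  then have "\<Delta> \<turnstile> Exists (At Tru (lift_tm (lift_tm \<mu>)) (CPair (lift_tm (lift_tm n)) (Var 0)))"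
    by (intro ExI[of _ _ m]) (simp add: At_curry)
  then have "\<Delta> \<turnstile> Mean (lift_tm n)"
    using \<Delta> unfolding paradox_context_def by (blast intro: ImplE ConjE2 meaning_enumerator_iff)
  then show "\<Delta> \<turnstile> At Mean (lift_tm (const_index n)) m"
    by (simp add: At_iff[OF _ App_const])
qed

lemma Mean_liar:
  assumes "paradox_context Xi \<mu> b \<Gamma>"
  shows "\<Gamma> \<turnstile> Mean (liar Xi \<mu> b)"
  unfolding liar_def
proof (rule Mean_XiI)
  show "\<Gamma> \<turnstile> X2 Xi" using assms by (simp add: paradox_context_def)
next
  fix \<Delta> m assume "lift_fm ` \<Gamma> \<subseteq> \<Delta>"
  then have \<Delta>: "paradox_context Xi (lift_tm \<mu>) (lift_tm b) \<Delta>" using assms by (rule paradox_context_lift[rotated])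
  then show "\<Delta> \<turnstile> At Mean (lift_tm (liar_fun Xi \<mu> b)) m"
    by (simp add: At_iff[OF _ App_liar_fun] Mean_guarded)
  show "\<Delta> \<turnstile> At Mean (lift_tm (const_index b)) m"
    using \<Delta> by (simp add: At_iff[OF _ App_const] paradox_context_def)
qed

lemma Tru_guardedI:
  assumes "paradox_context Xi \<mu> b \<Gamma>" and n: "\<Gamma> \<turnstile> Tru n"
  shows "\<Gamma> \<turnstile> Tru (guarded Xi \<mu> n)"
  unfolding guarded_def
proof (rule Tru_XiI)
  show "\<Gamma> \<turnstile> X1 Xi" using assms(1) by (simp add: paradox_context_def)
  show "\<Gamma> \<turnstile> Mean (Fn Xi [curry_index \<mu> n, const_index n])"
    using Mean_guarded[OF assms(1)] by (simp add: guarded_def)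
next
  fix \<Delta> m assume "lift_fm ` \<Gamma> \<subseteq> \<Delta>"
  from prov_lift[OF n this] show "\<Delta> \<turnstile> At Tru (lift_tm (const_index n)) m"
    by (simp add: At_iff[OF _ App_const])
qed

lemma Tru_guardedD:
  assumes "paradox_context Xi \<mu> b \<Gamma>" and n: "\<Gamma> \<turnstile> Mean n" and c: "\<Gamma> \<turnstile> Tru (guarded Xi \<mu> n)"
  shows "\<Gamma> \<turnstile> Tru n"
proof -
  \<comment> \<open>Meaningfulness of n supplies an m at which the antecedent of the guarded
    condition is true; detaching there leaves n.\<close>
  have "\<Gamma> \<turnstile> Exists (At Tru (lift_tm \<mu>) (CPair (lift_tm n) (Var 0)))"
    using assms unfolding paradox_context_def by (blast intro: ImplE ConjE1 meaning_enumerator_iff)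
  then show ?thesis
  proof (rule ExE_context)
    fix \<Delta>
    assume sub: "lift_fm ` \<Gamma> \<subseteq> \<Delta>" and m: "\<Delta> \<turnstile> At Tru (lift_tm \<mu>) (CPair (lift_tm n) (Var 0))"
    from assms(1) sub have \<Delta>: "paradox_context Xi (lift_tm \<mu>) (lift_tm b) \<Delta>" by (rule paradox_context_lift)
    have "\<Delta> \<turnstile> At Tru (const_index (lift_tm n)) (Var 0)"
    proof (rule Tru_XiD)
      show "\<Delta> \<turnstile> X1 Xi" using \<Delta> by (simp add: paradox_context_def)
      show "\<Delta> \<turnstile> Mean (Fn Xi [curry_index (lift_tm \<mu>) (lift_tm n), const_index (lift_tm n)])"
        using Mean_guarded[OF \<Delta>] by (simp add: guarded_def)
      show "\<Delta> \<turnstile> Tru (Fn Xi [curry_index (lift_tm \<mu>) (lift_tm n), const_index (lift_tm n)])"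
        using prov_lift[OF c sub] by (simp add: guarded_def)
      show "\<Delta> \<turnstile> At Tru (curry_index (lift_tm \<mu>) (lift_tm n)) (Var 0)"
        using m by (simp add: At_curry)
    qed
    then show "\<Delta> \<turnstile> lift_fm (Tru n)" by (simp add: At_iff[OF _ App_const])
  qed
qed

lemma not_Tru_liar:
  assumes "paradox_context Xi \<mu> b \<Gamma>" and "\<Gamma> \<turnstile> Tru (liar Xi \<mu> b)"
  shows "\<Gamma> \<turnstile> Falsum"
proof -
  \<comment> \<open>Both components of the liar are constant functions, so any argument
    serves.\<close>
  have "\<Gamma> \<turnstile> At Tru (liar_fun Xi \<mu> b) Zero"
    using Tru_guardedI[OF assms] by (simp add: At_iff[OF _ App_liar_fun])
  then have "\<Gamma> \<turnstile> At Tru (const_index b) Zero"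
    using assms Mean_liar[OF assms(1)] unfolding liar_def paradox_context_def by (blast intro: Tru_XiD)
  then have "\<Gamma> \<turnstile> Tru b" by (simp add: At_iff[OF _ App_const])
  with assms(1) show ?thesis unfolding paradox_context_def by (blast intro: ImplE)
qed

text \<open>A true antecedent would make the guarded liar true. As the liar is meaningful, the guard
  can be removed, so the liar itself would be true, contrary to \<open>not_Tru_liar\<close> in the
  extended context. The implication therefore holds by ex falso, without excluded middle.\<close>

lemma Tru_liar:
  assumes "paradox_context Xi \<mu> b \<Gamma>"
  shows "\<Gamma> \<turnstile> Tru (liar Xi \<mu> b)"
  unfolding liar_def
proof (rule Tru_XiI)
  show "\<Gamma> \<turnstile> X1 Xi" using assms by (simp add: paradox_context_def)
  show "\<Gamma> \<turnstile> Mean (Fn Xi [liar_fun Xi \<mu> b, const_index b])"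
    using Mean_liar[OF assms] by (simp add: liar_def)
next
  fix \<Delta> m
  assume sub: "lift_fm ` \<Gamma> \<subseteq> \<Delta>" and "\<Delta> \<turnstile> At Tru (lift_tm (liar_fun Xi \<mu> b)) m"
  from assms sub have \<Delta>: "paradox_context Xi (lift_tm \<mu>) (lift_tm b) \<Delta>" by (rule paradox_context_lift)
  from \<open>\<Delta> \<turnstile> At Tru _ m\<close> have "\<Delta> \<turnstile> Tru (guarded Xi (lift_tm \<mu>) (liar Xi (lift_tm \<mu>) (lift_tm b)))"
    by (simp add: At_iff[OF _ App_liar_fun])
  then have "\<Delta> \<turnstile> Tru (liar Xi (lift_tm \<mu>) (lift_tm b))"
    by (rule Tru_guardedD[OF \<Delta> Mean_liar[OF \<Delta>]])
  then have "\<Delta> \<turnstile> Falsum" by (rule not_Tru_liar[OF \<Delta>])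
  then show "\<Delta> \<turnstile> At Tru (lift_tm (const_index b)) m" by (rule FalsumE)
qed

theorem theorem13:
  fixes Xi :: prfun
  assumes "{} \<turnstile> Xi_injective Xi"
  shows "{X1 Xi, X2 Xi, Bottom} \<turnstile>
    \<^bold>\<not> Exists (Forall (Forall (Defined (Var 2) (CPair (Var 1) (Var 0)) \<^bold>\<and> At Mean (Var 2) (CPair (Var 1) (Var 0))))
           \<^bold>\<and> Forall (Mean (Var 0) \<^bold>\<longleftrightarrow> Exists (At Tru (Var 2) (CPair (Var 1) (Var 0)))))"
proof (rule ImplI_context, erule ExE_context)
  fix \<Gamma> \<Delta>
  assume sub: "{X1 Xi, X2 Xi, Bottom} \<subseteq> \<Gamma>" "lift_fm ` \<Gamma> \<subseteq> \<Delta>"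
    and "\<Delta> \<turnstile> Forall (Forall (Defined (Var 2) (CPair (Var 1) (Var 0)) \<^bold>\<and> At Mean (Var 2) (CPair (Var 1) (Var 0))))
           \<^bold>\<and> Forall (Mean (Var 0) \<^bold>\<longleftrightarrow> Exists (At Tru (Var 2) (CPair (Var 1) (Var 0))))"
  \<comment> \<open>With \<mu> as index 0, the two lifts in \<open>meaning_enumerator\<close>
    produce the index 2 of the stated formula.\<close>
  then have \<mu>: "\<Delta> \<turnstile> meaning_enumerator (Var 0)"
    by (simp add: meaning_enumerator_def numeral_2_eq_2)
  have ax: "X1 Xi \<in> \<Delta>" "X2 Xi \<in> \<Delta>" "lift_fm Bottom \<in> \<Delta>"
    using sub lift_X1_X2[of Xi] by (auto simp: image_subset_iff)
  then have "\<Delta> \<turnstile> Exists (Mean (Var 0) \<^bold>\<and> \<^bold>\<not> Tru (Var 0))"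
    using assm[OF ax(3)] by (simp add: Bottom_def lift_fm_def)
  then show "\<Delta> \<turnstile> lift_fm Falsum"
  proof (rule ExE_context)
    fix D assume "lift_fm ` \<Delta> \<subseteq> D" and b: "D \<turnstile> Mean (Var 0) \<^bold>\<and> \<^bold>\<not> Tru (Var 0)"
    \<comment> \<open>Opening the existential quantifier for \<bottom> gives b the index 0 and
      shifts \<mu> to index 1.\<close>
    then have "paradox_context Xi (lift_tm (Var 0)) (Var 0) D"
      using prov_lift[OF assm[OF ax(1)]] prov_lift[OF assm[OF ax(2)]] prov_lift[OF \<mu>]
      unfolding paradox_context_def by (auto intro: ConjE1 ConjE2)
    then show "D \<turnstile> lift_fm (lift_fm Falsum)"
      using not_Tru_liar Tru_liar by simp
  qed
qed

end
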